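(* (Subject Reduction for $\lambda LL$.) Let $\Gamma\vdash M:A$ be a derivable typing judgment of $\lambda LL$ and let $M\rightarrow N$ be a $\beta$-reduction step. Then $\Gamma\vdash N:A$ is derivable.
   Context: **Calculus $\lambda LL$.** Fix function symbols $\underline f$ with arities $n\ge 1$, each denoting a differentiable $f:\mathbb R^n\to\mathbb R$. Types: $A,B::=\mathbb R\mid A\multimap B\mid 1\mid A\otimes B\mid\top\mid A\& B\mid {!A}$. Each variable has a type fixed once and for all. Patterns: $p,q::=x\mid {!x}\mid ()\mid (p,q)\mid\langle p,q\rangle$, with no variable occurring twice; if $x$ has type $A$ then pattern $x$ has type $A$ and pattern $!x$ has type $!A$; $()$ has type $1$; $(p,q)$ has type $A\otimes B$ and $\langle p,q\rangle$ type $A\& B$ when $p:A$, $q:B$. Patterns $!x$ are called exponential. An environment is a finite set of typed patterns with pairwise disjoint variables; $!\Gamma$ denotes an environment all of whose patterns are exponential; the comma is union of environments having no variable in common. Terms (up to $\alpha$-equivalence): $M,N::=x\mid {!M}\mid\lambda p.M\mid MN\mid ()\mid (M,N)\mid\langle\rangle\mid\langle M,N\rangle\mid\underline r\ (r\in\mathbb R)\mid\underline f\mid\dot+\mid\dot*$. Typing rules: - $x:A\vdash x:A$; $\;!x:{!A}\vdash x:A$; - from $!\Gamma\vdash M:A$ infer $!\Gamma\vdash {!M}:{!A}$; from $\Delta\vdash M:B$ infer $!x:{!A},\Delta\vdash M:B$; - from $p:A,\Delta\vdash M:B$ infer $\Delta\vdash\lambda p.M:A\multimap B$; - from $!\Gamma_1,\Delta_1\vdash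 M:A\multimap B$ and $!\Gamma_2,\Delta_2\vdash N:A$ infer $!\Gamma_1\cup{!\Gamma_2},\Delta_1,\Delta_2\vdash MN:B$; - $\vdash ():1$; from $\Delta\vdash M:B$ infer $():1,\Delta\vdash M:B$; - from $!\Gamma_1,\Delta_1\vdash M:A$ and $!\Gamma_2,\Delta_2\vdash N:B$ infer $!\Gamma_1\cup{!\Gamma_2},\Delta_1,\Delta_2\vdash(M,N):A\otimes B$; from $p:A,q:B,\Delta\vdash M:C$ infer $(p,q):A\otimes B,\Delta\vdash M:C$; - from $\Delta\vdash M_1:A_1$ and $\Delta\vdash M_2:A_2$ infer $\Delta\vdash\langle M_1,M_2\rangle:A_1\& A_2$; for $i\in\{1,2\}$, from $p_i:A_i,\Delta\vdash M:B$ infer $\langle p_1,p_2\rangle:A_1\& A_2,\Delta\vdash M:B$; $\Delta\vdash\langle\rangle:\top$ for any $\Delta$; - $\vdash\underline r:\mathbb R$; $\Delta\vdash\underline 0:\mathbb R$ for any $\Delta$; $\vdash\underline f:({!\mathbb R}\otimes\dots\otimes{!\mathbb R})\multimap{!\mathbb R}$ ($n$ factors); $\vdash\dot+:(\mathbb R\&\mathbb R)\multimap\mathbb R$; $\vdash\dot*:\mathbb R\multimap\mathbb R\multimap\mathbb R$. **$\beta$-reduction.** Values for a pattern: any term of type $A$ is a value for a variable $x:A$; $()$ is the value for $()$; $!M$ (any $M$) is a value for $!x$; $(V_1,V_2)$ (resp. $\langle V_1,V_2\rangle$) is a value for $(p_1,p_2)$ (resp. $\langle p_1,p_2\rangle$)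 if each $V_i$ is a value for $p_i$. Substitution: $M\{V/x\}$ is capture-avoiding substitution, $M\{()/()\}=M$, $M\{!N/!x\}=M\{N/x\}$, $M\{(V_1,V_2)/(p_1,p_2)\}=M\{\langle V_1,V_2\rangle/\langle p_1,p_2\rangle\}=M\{V_1/p_1\}\{V_2/p_2\}$. The relation $\rightarrow$ is the closure under all one-hole term contexts of: $(\lambda p.M)V\rightarrow M\{V/p\}$ for $V$ a value for $p$; $\underline f(!\underline{r_1},\dots,!\underline{r_n})\rightarrow{!\underline{f(r_1,\dots,r_n)}}$; $\dot+\langle\underline{r_1},\underline{r_2}\rangle\rightarrow\underline{r_1+r_2}$; $\dot*\,\underline{r_1}\,\underline{r_2}\rightarrow\underline{r_1\cdot r_2}$. ($n$-fold $\otimes$ and pairs are right-nested.) *)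

theory Defs
  imports "HOL-Analysis.Analysis"
begin

datatype ty =
    TReal
  | Lolli ty ty  (infixr "\<multimap>" 60)
  | One
  | Tensor ty ty
  | Top
  | With ty ty
  | OfCourse ty

text \<open>
  A variable is a name paired with its type. Hence the type of a variable is fixed once and
  for all, and every type has infinitely many variables.
\<close>

type_synonym var = "nat \<times> ty"

datatype 'v pat =
    PVar 'v
  | PBang 'v
  | PUnit
  | PTensor "'v pat" "'v pat"
  | PWith "'v pat" "'v pat"

primrec vars :: "'v pat \<Rightarrow> 'v list" where
  "vars (PVar x) = [x]"
| "vars (PBang x) = [x]"
| "vars PUnit = []"
| "vars (PTensor p q) = vars p @ vars q"
| "vars (PWith p q) = vars p @ vars q"

definition lin :: "'v pat \<Rightarrow> bool" where
  "lin p \<longleftrightarrow> distinct (vars p)"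

primrec pty :: "var pat \<Rightarrow> ty" where
  "pty (PVar x) = snd x"
| "pty (PBang x) = OfCourse (snd x)"
| "pty PUnit = One"
| "pty (PTensor p q) = Tensor (pty p) (pty q)"
| "pty (PWith p q) = With (pty p) (pty q)"

text \<open>
  Since \<^term>\<open>pty\<close> determines the type of a pattern, an environment is just a finite set of
  patterns. The comma of two environments is their union, subject to the relation \<open>##\<close> below.
\<close>

definition evars :: "var pat set \<Rightarrow> var set" where
  "evars \<Gamma> = (\<Union>p\<in>\<Gamma>. set (vars p))"

definition env :: "var pat set \<Rightarrow> bool" where
  "env \<Gamma> \<longleftrightarrow> finite \<Gamma> \<and> (\<forall>p\<in>\<Gamma>. lin p) \<and>
     (\<forall>p\<in>\<Gamma>. \<forall>q\<in>\<Gamma>. p \<noteq> q \<longrightarrow> set (vars p) \<inter> set (vars q) = {})"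

definition separate :: "var pat set \<Rightarrow> var pat set \<Rightarrow> bool"  (infix "##" 50) where
  "\<Gamma> ## \<Delta> \<longleftrightarrow> evars \<Gamma> \<inter> evars \<Delta> = {}"

definition exponential :: "var pat set \<Rightarrow> bool" where
  "exponential \<Gamma> \<longleftrightarrow> (\<forall>p\<in>\<Gamma>. \<exists>x. p = PBang x)"


text \<open>
  Terms up to alpha-equivalence are represented in locally nameless style. In
  \<open>Abs s M\<close> the binder \<open>s\<close> is a pattern whose variables are replaced by their types, and
  \<open>BVar k i\<close> is the \<open>i\<close>-th variable (from left to right) of the pattern at the
  \<open>k\<close>-th enclosing abstraction. The abstraction of the calculus, with a
  named pattern, is \<open>Lam\<close> below; \<open>is_term\<close> is the grammar of terms and excludes raw
  terms with dangling indices. All later definitions use \<open>Lam\<close> only.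
\<close>

datatype (fv: 'v, syms: 'f) trm =
    FVar 'v
  | BVar nat nat
  | Abs "ty pat" "('v, 'f) trm"
  | Bang "('v, 'f) trm"
  | App "('v, 'f) trm" "('v, 'f) trm"
  | TUnit
  | TPair "('v, 'f) trm" "('v, 'f) trm"
  | WUnit
  | WPair "('v, 'f) trm" "('v, 'f) trm"
  | Const real
  | Sym 'f
  | Plus
  | Times
  for map: map_trm

type_synonym 'f tm = "(var, 'f) trm"

primrec close :: "'v list \<Rightarrow> nat \<Rightarrow> ('v, 'f) trm \<Rightarrow> ('v, 'f) trm" where
  "close xs k (FVar x) =
     (if x \<in> set xs then BVar k (length (takeWhile (\<lambda>y. y \<noteq> x) xs)) else FVar x)"
| "close xs k (BVar j i) = BVar j i"
| "close xs k (Abs s M) = Abs s (close xs (Suc k) M)"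
| "close xs k (Bang M) = Bang (close xs k M)"
| "close xs k (App M N) = App (close xs k M) (close xs k N)"
| "close xs k TUnit = TUnit"
| "close xs k (TPair M N) = TPair (close xs k M) (close xs k N)"
| "close xs k WUnit = WUnit"
| "close xs k (WPair M N) = WPair (close xs k M) (close xs k N)"
| "close xs k (Const r) = Const r"
| "close xs k (Sym f) = Sym f"
| "close xs k Plus = Plus"
| "close xs k Times = Times"

definition Lam :: "var pat \<Rightarrow> 'f tm \<Rightarrow> 'f tm" where
  "Lam p M = Abs (map_pat snd p) (close (vars p) 0 M)"

inductive is_term :: "'f tm \<Rightarrow> bool" where
  "is_term (FVar x)"
| "is_term M \<Longrightarrow> is_term (Bang M)"
| "lin p \<Longrightarrow> is_term M \<Longrightarrow> is_term (Lam p M)"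
| "is_term M \<Longrightarrow> is_term N \<Longrightarrow> is_term (App M N)"
| "is_term TUnit"
| "is_term M \<Longrightarrow> is_term N \<Longrightarrow> is_term (TPair M N)"
| "is_term WUnit"
| "is_term M \<Longrightarrow> is_term N \<Longrightarrow> is_term (WPair M N)"
| "is_term (Const r)"
| "is_term (Sym f)"
| "is_term Plus"
| "is_term Times"

text \<open>Alpha-equivalent named abstractions are equal:\<close>

lemma vars_map_pat: "vars (map_pat \<sigma> p) = map \<sigma> (vars p)"
  by (induction p) auto

lemma takeWhile_map_inj:
  assumes "inj_on \<sigma> (insert x (set xs))"
  shows "length (takeWhile (\<lambda>y. y \<noteq> \<sigma> x) (map \<sigma> xs)) = length (takeWhile (\<lambda>y. y \<noteq> x) xs)"
  using assms
proof (induction xs)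
  case (Cons a xs)
  have "inj_on \<sigma> (insert x (set xs))"
    by (rule inj_on_subset[OF Cons.prems]) auto
  moreover have "\<sigma> a = \<sigma> x \<longleftrightarrow> a = x"
    using Cons.prems by (auto simp: inj_on_def)
  ultimately show ?case
    using Cons.IH by simp
qed simp

lemma close_rename:
  assumes "inj_on \<sigma> (S \<union> set xs)" and "\<And>x. x \<in> S - set xs \<Longrightarrow> \<sigma> x = x" and "fv M \<subseteq> S"
  shows "close (map \<sigma> xs) k (map_trm \<sigma> id M) = close xs k M"
  using assms(3)
proof (induction M arbitrary: k)
  case (FVar x)
  then have "x \<in> S"
    by simp
  then have "\<sigma> x \<in> \<sigma> ` set xs \<longleftrightarrow> x \<in> set xs"
    using assms(1) by (auto simp: inj_on_def)
  moreover have "inj_on \<sigma> (insert x (set xs))"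
    by (rule inj_on_subset[OF assms(1)]) (use \<open>x \<in> S\<close> in auto)
  ultimately show ?case
    using takeWhile_map_inj[of \<sigma> x xs] assms(2)[of x] \<open>x \<in> S\<close> by auto
qed simp_all

lemma Lam_rename:
  fixes \<sigma> :: "var \<Rightarrow> var"
  assumes "inj_on \<sigma> (fv M \<union> set (vars p))" and "\<And>x. x \<in> fv M - set (vars p) \<Longrightarrow> \<sigma> x = x"
    and "\<And>x. snd (\<sigma> x) = snd x"
  shows "Lam (map_pat \<sigma> p) (map_trm \<sigma> id M) = Lam p M"
proof -
  have "snd \<circ> \<sigma> = snd"
    using assms(3) by auto
  then show ?thesis
    using close_rename[OF assms(1,2) order_refl] by (simp add: Lam_def vars_map_pat pat.map_comp)
qed

text \<open>No index is shifted because \<open>N\<close> will always satisfy \<^term>\<open>is_term\<close>.\<close>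

primrec subst :: "'v \<Rightarrow> ('v, 'f) trm \<Rightarrow> ('v, 'f) trm \<Rightarrow> ('v, 'f) trm" where
  "subst x N (FVar y) = (if y = x then N else FVar y)"
| "subst x N (BVar j i) = BVar j i"
| "subst x N (Abs s M) = Abs s (subst x N M)"
| "subst x N (Bang M) = Bang (subst x N M)"
| "subst x N (App M M') = App (subst x N M) (subst x N M')"
| "subst x N TUnit = TUnit"
| "subst x N (TPair M M') = TPair (subst x N M) (subst x N M')"
| "subst x N WUnit = WUnit"
| "subst x N (WPair M M') = WPair (subst x N M) (subst x N M')"
| "subst x N (Const r) = Const r"
| "subst x N (Sym f) = Sym f"
| "subst x N Plus = Plus"
| "subst x N Times = Times"

text \<open>\<open>psubst p V M\<close> is \<open>M{V/p}\<close>; it is left undefined if \<open>V\<close> does not match \<open>p\<close>.\<close>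

fun psubst :: "'v pat \<Rightarrow> ('v, 'f) trm \<Rightarrow> ('v, 'f) trm \<Rightarrow> ('v, 'f) trm" where
  "psubst (PVar x) V M = subst x V M"
| "psubst PUnit TUnit M = M"
| "psubst (PBang x) (Bang N) M = subst x N M"
| "psubst (PTensor p q) (TPair V W) M = psubst q W (psubst p V M)"
| "psubst (PWith p q) (WPair V W) M = psubst q W (psubst p V M)"


text \<open>
  Function symbols are the elements of a type \<open>'f\<close>; \<open>ar\<close> gives their arities, and \<open>den\<close> the
  functions they denote, as functions on lists of which only the lists of length \<open>ar f\<close> matter.
  The dimension is a natural number rather than a type, so Frechet differentiability on
  \<open>n\<close>-dimensional space is spelled out for lists of length \<open>n\<close>.
\<close>

definition differentiable_Rn :: "nat \<Rightarrow> (real list \<Rightarrow> real) \<Rightarrow> bool" where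
  "differentiable_Rn n f \<longleftrightarrow>
     (\<forall>xs. length xs = n \<longrightarrow>
       (\<exists>c :: nat \<Rightarrow> real. \<forall>e>0. \<exists>d>0. \<forall>ys.
          length ys = n \<and> L2_set (\<lambda>i. ys ! i - xs ! i) {..<n} < d \<longrightarrow>
          \<bar>f ys - f xs - (\<Sum>i<n. c i * (ys ! i - xs ! i))\<bar>
            \<le> e * L2_set (\<lambda>i. ys ! i - xs ! i) {..<n}))"

definition signature :: "('f \<Rightarrow> nat) \<Rightarrow> ('f \<Rightarrow> real list \<Rightarrow> real) \<Rightarrow> bool" where
  "signature ar den \<longleftrightarrow> (\<forall>f. 1 \<le> ar f \<and> differentiable_Rn (ar f) (den f))"

text \<open>Right-nested iteration of a binary operation over a nonempty list.\<close>

fun nest :: "('a \<Rightarrow> 'a \<Rightarrow> 'a) \<Rightarrow> 'a list \<Rightarrow> 'a" where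
  "nest g [a] = a"
| "nest g (a # b # as) = g a (nest g (b # as))"


inductive typing :: "('f \<Rightarrow> nat) \<Rightarrow> var pat set \<Rightarrow> 'f tm \<Rightarrow> ty \<Rightarrow> bool"
  for ar :: "'f \<Rightarrow> nat" where
  ax: "typing ar {PVar x} (FVar x) (snd x)"
| der: "typing ar {PBang x} (FVar x) (snd x)"
| prom: "exponential \<Gamma> \<Longrightarrow> typing ar \<Gamma> M A \<Longrightarrow> typing ar \<Gamma> (Bang M) (OfCourse A)"
| weak: "typing ar \<Delta> M B \<Longrightarrow> {PBang x} ## \<Delta> \<Longrightarrow> typing ar ({PBang x} \<union> \<Delta>) M B"
| lam: "typing ar ({p} \<union> \<Delta>) M B \<Longrightarrow> {p} ## \<Delta> \<Longrightarrow> typing ar \<Delta> (Lam p M) (pty p \<multimap> B)"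
| app: "exponential \<Gamma>1 \<Longrightarrow> exponential \<Gamma>2 \<Longrightarrow>
    typing ar (\<Gamma>1 \<union> \<Delta>1) M (A \<multimap> B) \<Longrightarrow> typing ar (\<Gamma>2 \<union> \<Delta>2) N A \<Longrightarrow>
    \<Gamma>1 \<union> \<Gamma>2 ## \<Delta>1 \<Longrightarrow> \<Gamma>1 \<union> \<Gamma>2 ## \<Delta>2 \<Longrightarrow> \<Delta>1 ## \<Delta>2 \<Longrightarrow>
    typing ar (\<Gamma>1 \<union> \<Gamma>2 \<union> \<Delta>1 \<union> \<Delta>2) (App M N) B"
| unitR: "typing ar {} TUnit One"
| unitL: "typing ar \<Delta> M B \<Longrightarrow> typing ar ({PUnit} \<union> \<Delta>) M B"
| tensorR: "exponential \<Gamma>1 \<Longrightarrow> exponential \<Gamma>2 \<Longrightarrow>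
    typing ar (\<Gamma>1 \<union> \<Delta>1) M A \<Longrightarrow> typing ar (\<Gamma>2 \<union> \<Delta>2) N B \<Longrightarrow>
    \<Gamma>1 \<union> \<Gamma>2 ## \<Delta>1 \<Longrightarrow> \<Gamma>1 \<union> \<Gamma>2 ## \<Delta>2 \<Longrightarrow> \<Delta>1 ## \<Delta>2 \<Longrightarrow>
    typing ar (\<Gamma>1 \<union> \<Gamma>2 \<union> \<Delta>1 \<union> \<Delta>2) (TPair M N) (Tensor A B)"
| tensorL: "typing ar ({p} \<union> {q} \<union> \<Delta>) M C \<Longrightarrow>
    {p} ## {q} \<Longrightarrow> {p} ## \<Delta> \<Longrightarrow> {q} ## \<Delta> \<Longrightarrow>
    typing ar ({PTensor p q} \<union> \<Delta>) M C"
| withR: "typing ar \<Delta> M A \<Longrightarrow> typing ar \<Delta> N B \<Longrightarrow> typing ar \<Delta> (WPair M N) (With A B)"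
| withL1: "typing ar ({p} \<union> \<Delta>) M B \<Longrightarrow> lin (PWith p q) \<Longrightarrow> {PWith p q} ## \<Delta> \<Longrightarrow>
    typing ar ({PWith p q} \<union> \<Delta>) M B"
| withL2: "typing ar ({q} \<union> \<Delta>) M B \<Longrightarrow> lin (PWith p q) \<Longrightarrow> {PWith p q} ## \<Delta> \<Longrightarrow>
    typing ar ({PWith p q} \<union> \<Delta>) M B"
| topR: "env \<Delta> \<Longrightarrow> typing ar \<Delta> WUnit Top"
| const: "typing ar {} (Const r) TReal"
| zero: "env \<Delta> \<Longrightarrow> typing ar \<Delta> (Const 0) TReal"
| sym: "typing ar {} (Sym f) (nest Tensor (replicate (ar f) (OfCourse TReal)) \<multimap> OfCourse TReal)"
| plus: "typing ar {} Plus (With TReal TReal \<multimap> TReal)"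
| times: "typing ar {} Times (TReal \<multimap> TReal \<multimap> TReal)"

text \<open>The rules keep environments well formed, and only terms are typable:\<close>

lemma env_Un:
  assumes "env \<Gamma>" "env \<Delta>"
    and "\<And>p q. p \<in> \<Gamma> \<Longrightarrow> q \<in> \<Delta> \<Longrightarrow> p \<noteq> q \<Longrightarrow> set (vars p) \<inter> set (vars q) = {}"
  shows "env (\<Gamma> \<union> \<Delta>)"
proof -
  have "set (vars p) \<inter> set (vars q) = {}" if "p \<in> \<Gamma> \<union> \<Delta>" "q \<in> \<Gamma> \<union> \<Delta>" "p \<noteq> q" for p q
  proof -
    consider "p \<in> \<Gamma>" "q \<in> \<Gamma>" | "p \<in> \<Delta>" "q \<in> \<Delta>" | "p \<in> \<Gamma>" "q \<in> \<Delta>" | "q \<in> \<Gamma>" "p \<in> \<Delta>"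
      using \<open>p \<in> \<Gamma> \<union> \<Delta>\<close> \<open>q \<in> \<Gamma> \<union> \<Delta>\<close> by blast
    then show ?thesis
    proof cases
      case 1
      with assms(1) \<open>p \<noteq> q\<close> show ?thesis by (simp add: env_def)
    next
      case 2
      with assms(2) \<open>p \<noteq> q\<close> show ?thesis by (simp add: env_def)
    next
      case 3
      with assms(3) \<open>p \<noteq> q\<close> show ?thesis by simp
    next
      case 4
      with assms(3)[of q p] \<open>p \<noteq> q\<close> show ?thesis by (simp add: Int_commute)
    qed
  qed
  then show ?thesis
    using assms(1,2) by (simp add: env_def ball_Un)
qed

lemma env_comma: "env \<Gamma> \<Longrightarrow> env \<Delta> \<Longrightarrow> \<Gamma> ## \<Delta> \<Longrightarrow> env (\<Gamma> \<union> \<Delta>)"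
  by (rule env_Un) (auto simp: separate_def evars_def)

lemma env_mono: "env \<Gamma> \<Longrightarrow> \<Delta> \<subseteq> \<Gamma> \<Longrightarrow> env \<Delta>"
  unfolding env_def by (meson finite_subset subsetD)

lemma env_exponential_Un:
  assumes "exponential \<Gamma>" "exponential \<Delta>" "env \<Gamma>" "env \<Delta>"
  shows "env (\<Gamma> \<union> \<Delta>)"
proof (rule env_Un[OF assms(3,4)])
  fix p q
  assume "p \<in> \<Gamma>" "q \<in> \<Delta>" "p \<noteq> q"
  moreover from this obtain x y where "p = PBang x" "q = PBang y"
    using assms(1,2) unfolding exponential_def by blast
  ultimately show "set (vars p) \<inter> set (vars q) = {}"
    by simp
qed

lemma env_mult:
  assumes "exponential \<Gamma>1" "exponential \<Gamma>2" "env (\<Gamma>1 \<union> \<Delta>1)" "env (\<Gamma>2 \<union> \<Delta>2)"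
    and "\<Gamma>1 \<union> \<Gamma>2 ## \<Delta>1" "\<Gamma>1 \<union> \<Gamma>2 ## \<Delta>2" "\<Delta>1 ## \<Delta>2"
  shows "env (\<Gamma>1 \<union> \<Gamma>2 \<union> \<Delta>1 \<union> \<Delta>2)"
proof -
  have "env \<Gamma>1" "env \<Delta>1" "env \<Gamma>2" "env \<Delta>2"
    using env_mono[OF assms(3)] env_mono[OF assms(4)] by simp_all
  then have "env (\<Gamma>1 \<union> \<Gamma>2)"
    using env_exponential_Un assms(1,2) by blast
  then have "env (\<Gamma>1 \<union> \<Gamma>2 \<union> \<Delta>1)"
    using env_comma \<open>env \<Delta>1\<close> assms(5) by blast
  moreover have "\<Gamma>1 \<union> \<Gamma>2 \<union> \<Delta>1 ## \<Delta>2"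
    using assms(6,7) unfolding separate_def evars_def by blast
  ultimately show ?thesis
    using env_comma \<open>env \<Delta>2\<close> by blast
qed

lemma typing_env: "typing ar \<Gamma> M A \<Longrightarrow> env \<Gamma>"
proof (induction rule: typing.induct)
  case (weak \<Delta> M B x)
  then show ?case by (intro env_comma) (auto simp: env_def lin_def)
next
  case (lam p \<Delta> M B)
  from env_mono[OF lam.IH, of \<Delta>] show ?case by blast
next
  case (app \<Gamma>1 \<Gamma>2 \<Delta>1 M A B \<Delta>2 N)
  then show ?case by (intro env_mult)
next
  case (tensorR \<Gamma>1 \<Gamma>2 \<Delta>1 M A \<Delta>2 N B)
  then show ?case by (intro env_mult)
next
  case (unitL \<Delta> M B)
  then show ?case by (intro env_comma) (auto simp: env_def lin_def separate_def evars_def)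
next
  case (tensorL p q \<Delta> M C)
  have "env \<Delta>" using env_mono[OF tensorL.IH, of \<Delta>] by blast
  with tensorL show ?case
    by (intro env_comma) (auto simp: env_def lin_def separate_def evars_def)
next
  case (withL1 p \<Delta> M B q)
  have "env \<Delta>" using env_mono[OF withL1.IH, of \<Delta>] by blast
  with withL1 show ?case by (intro env_comma) (auto simp: env_def)
next
  case (withL2 q \<Delta> M B p)
  have "env \<Delta>" using env_mono[OF withL2.IH, of \<Delta>] by blast
  with withL2 show ?case by (intro env_comma) (auto simp: env_def)
qed (auto simp: env_def lin_def)

lemma typing_is_term: "typing ar \<Gamma> M A \<Longrightarrow> is_term M"
proof (induction rule: typing.induct)
  case (lam p \<Delta> M B)
  then have "lin p" using typing_env by (force simp: env_def)
  with lam show ?case by (auto intro: is_term.intros)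
qed (auto intro: is_term.intros)


inductive is_value :: "('f \<Rightarrow> nat) \<Rightarrow> var pat \<Rightarrow> 'f tm \<Rightarrow> bool" for ar :: "'f \<Rightarrow> nat" where
  "typing ar \<Delta> V (snd x) \<Longrightarrow> is_value ar (PVar x) V"
| "is_value ar PUnit TUnit"
| "is_term M \<Longrightarrow> is_value ar (PBang x) (Bang M)"
| "is_value ar p V \<Longrightarrow> is_value ar q W \<Longrightarrow> is_value ar (PTensor p q) (TPair V W)"
| "is_value ar p V \<Longrightarrow> is_value ar q W \<Longrightarrow> is_value ar (PWith p q) (WPair V W)"

text \<open>
  In \<open>beta\<close> the alpha-representative of the abstraction is chosen such that the variables of
  \<open>p\<close> are not free in \<open>V\<close>. This can always be done by \<open>Lam_rename\<close>, and is needed because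
  \<^term>\<open>psubst\<close> substitutes for the variables of \<open>p\<close> one after the other.
\<close>

inductive red :: "('f \<Rightarrow> nat) \<Rightarrow> ('f \<Rightarrow> real list \<Rightarrow> real) \<Rightarrow> 'f tm \<Rightarrow> 'f tm \<Rightarrow> bool"
  for ar :: "'f \<Rightarrow> nat" and den :: "'f \<Rightarrow> real list \<Rightarrow> real" where
  beta: "lin p \<Longrightarrow> is_term M \<Longrightarrow> is_value ar p V \<Longrightarrow> set (vars p) \<inter> fv V = {} \<Longrightarrow>
    red ar den (App (Lam p M) V) (psubst p V M)"
| sym: "length rs = ar f \<Longrightarrow>
    red ar den (App (Sym f) (nest TPair (map (\<lambda>r. Bang (Const r)) rs))) (Bang (Const (den f rs)))"
| plus: "red ar den (App Plus (WPair (Const r) (Const s))) (Const (r + s))"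
| times: "red ar den (App (App Times (Const r)) (Const s)) (Const (r * s))"
| bang: "red ar den M N \<Longrightarrow> red ar den (Bang M) (Bang N)"
| lam: "lin p \<Longrightarrow> is_term M \<Longrightarrow> red ar den M N \<Longrightarrow> red ar den (Lam p M) (Lam p N)"
| appL: "red ar den M N \<Longrightarrow> red ar den (App M P) (App N P)"
| appR: "red ar den M N \<Longrightarrow> red ar den (App P M) (App P N)"
| tpairL: "red ar den M N \<Longrightarrow> red ar den (TPair M P) (TPair N P)"
| tpairR: "red ar den M N \<Longrightarrow> red ar den (TPair P M) (TPair P N)"
| wpairL: "red ar den M N \<Longrightarrow> red ar den (WPair M P) (WPair N P)"
| wpairR: "red ar den M N \<Longrightarrow> red ar den (WPair P M) (WPair P N)"

end

theory Submission
  imports Defs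
begin

text \<open>
  The left rules can be used anywhere in a derivation, so a derivation is inverted only up to
  replacing the environment \<open>\<Gamma>\<close> by an environment \<open>\<Gamma>'\<close> that refines it, that is, from which
  \<open>\<Gamma>\<close> can be recovered in every context by left rules. The substitution lemma is proved for
  simultaneous substitutions: the patterns of the environment are replaced by values typed
  in pairwise joinable environments. The renaming of bound variables is an instance
  of it. Subject reduction is then proved for all substitution instances of a reduction step, so
  that the induction hypothesis survives the change of bound names that the inversion of the
  abstraction rule causes.
\<close>

section \<open>Simultaneous substitution\<close>

text \<open>Values are attached to whole patterns rather than to single variables, because the two
  components of a value for \<open>PWith p q\<close> are typed in one and the same environment, and
  \<open>withL1\<close> or \<open>withL2\<close> uses only one of them. Treating the variables
  separately would count that environment twice. The second obstacle is sharing. A value for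
  \<open>PBang x\<close> may be typed in \<open>{PTensor (PBang y) (PBang z)}\<close>, which cannot
  go to both premises of a multiplicative rule. Refining first replaces it by an exponential
  environment, which can. Finally, \<open>topR\<close> and \<open>zero\<close> accept every
  environment, so an environment cannot be read off from the free variables of a term. It is tracked
  explicitly, by a map \<open>G\<close> from patterns to environments.\<close>

primrec lc :: "nat \<Rightarrow> ('v, 'f) trm \<Rightarrow> bool" where
  "lc k (FVar x) = True"
| "lc k (BVar j i) = (j < k)"
| "lc k (Abs s M) = lc (Suc k) M"
| "lc k (Bang M) = lc k M"
| "lc k (App M N) = (lc k M \<and> lc k N)"
| "lc k TUnit = True"
| "lc k (TPair M N) = (lc k M \<and> lc k N)"
| "lc k WUnit = True"
| "lc k (WPair M N) = (lc k M \<and> lc k N)"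
| "lc k (Const r) = True"
| "lc k (Sym f) = True"
| "lc k Plus = True"
| "lc k Times = True"

text \<open>Images are inserted under \<open>Abs\<close> without shifting, which is harmless for
  locally closed images. Capture cannot occur, since bound variables carry no names.\<close>

primrec msubst :: "('v \<Rightarrow> ('v, 'f) trm) \<Rightarrow> ('v, 'f) trm \<Rightarrow> ('v, 'f) trm" where
  "msubst \<theta> (FVar x) = \<theta> x"
| "msubst \<theta> (BVar j i) = BVar j i"
| "msubst \<theta> (Abs s M) = Abs s (msubst \<theta> M)"
| "msubst \<theta> (Bang M) = Bang (msubst \<theta> M)"
| "msubst \<theta> (App M N) = App (msubst \<theta> M) (msubst \<theta> N)"
| "msubst \<theta> TUnit = TUnit"
| "msubst \<theta> (TPair M N) = TPair (msubst \<theta> M) (msubst \<theta> N)"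
| "msubst \<theta> WUnit = WUnit"
| "msubst \<theta> (WPair M N) = WPair (msubst \<theta> M) (msubst \<theta> N)"
| "msubst \<theta> (Const r) = Const r"
| "msubst \<theta> (Sym f) = Sym f"
| "msubst \<theta> Plus = Plus"
| "msubst \<theta> Times = Times"

text \<open>Undoes \<open>close\<close>, inserting arbitrary terms. It allows two named
  representatives of one abstraction to be compared through their common closed body.\<close>

primrec bopen :: "('v, 'f) trm list \<Rightarrow> nat \<Rightarrow> ('v, 'f) trm \<Rightarrow> ('v, 'f) trm" where
  "bopen vs k (FVar x) = FVar x"
| "bopen vs k (BVar j i) = (if j = k then vs ! i else BVar j i)"
| "bopen vs k (Abs s M) = Abs s (bopen vs (Suc k) M)"
| "bopen vs k (Bang M) = Bang (bopen vs k M)"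
| "bopen vs k (App M N) = App (bopen vs k M) (bopen vs k N)"
| "bopen vs k TUnit = TUnit"
| "bopen vs k (TPair M N) = TPair (bopen vs k M) (bopen vs k N)"
| "bopen vs k WUnit = WUnit"
| "bopen vs k (WPair M N) = WPair (bopen vs k M) (bopen vs k N)"
| "bopen vs k (Const r) = Const r"
| "bopen vs k (Sym f) = Sym f"
| "bopen vs k Plus = Plus"
| "bopen vs k Times = Times"

text \<open>The value for the pattern \<open>p\<close> whose components are given by \<open>\<theta>\<close>.\<close>

primrec plug :: "('v \<Rightarrow> ('w, 'f) trm) \<Rightarrow> 'v pat \<Rightarrow> ('w, 'f) trm" where
  "plug \<theta> (PVar x) = \<theta> x"
| "plug \<theta> (PBang x) = Bang (\<theta> x)"
| "plug \<theta> PUnit = TUnit"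
| "plug \<theta> (PTensor p q) = TPair (plug \<theta> p) (plug \<theta> q)"
| "plug \<theta> (PWith p q) = WPair (plug \<theta> p) (plug \<theta> q)"

section \<open>Locally closed terms, opening and closing\<close>

lemma lc_mono: "lc k M \<Longrightarrow> k \<le> l \<Longrightarrow> lc l M"
proof (induction M arbitrary: k l)
  case (Abs s M)
  then show ?case by (metis Suc_le_mono lc.simps(3))
qed auto

lemma lc_close: "lc k M \<Longrightarrow> lc (Suc k) (close xs k M)"
  by (induction M arbitrary: k) auto

lemma is_term_lc: "is_term M \<Longrightarrow> lc 0 M"
  by (induction rule: is_term.induct) (auto simp: Lam_def lc_close)

text \<open>\<open>lc\<close> bounds only the level \<open>j\<close> of an index
  \<open>BVar j i\<close>, and the level is all that \<open>bopen\<close> tests.\<close>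

lemma bopen_lc: "lc k M \<Longrightarrow> bopen vs k M = M"
  by (induction M arbitrary: k) auto

lemma fv_close: "fv (close xs k M) = fv M - set xs"
  by (induction M arbitrary: k) auto

lemma close_fresh: "fv M \<inter> set xs = {} \<Longrightarrow> close xs k M = M"
  by (induction M arbitrary: k) auto

lemma finite_fv: "finite (fv M)"
  by (induction M) auto

lemma fv_msubst: "fv (msubst \<theta> M) = (\<Union>x\<in>fv M. fv (\<theta> x))"
  by (induction M) auto

lemma msubst_cong: "(\<And>x. x \<in> fv M \<Longrightarrow> \<theta> x = \<eta> x) \<Longrightarrow> msubst \<theta> M = msubst \<eta> M"
  by (induction M) auto

lemma msubst_FVar: "msubst FVar M = M"
  by (induction M) auto

lemma msubst_msubst: "msubst \<theta> (msubst \<eta> M) = msubst (\<lambda>x. msubst \<theta> (\<eta> x)) M"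
  by (induction M) auto

lemma subst_msubst: "subst x N M = msubst (FVar(x := N)) M"
  by (induction M) auto

text \<open>A variable of \<open>xs\<close> is closed to its first position in \<open>xs\<close>,
  where \<open>map \<eta> xs\<close> returns its image. Images under \<open>\<theta>\<close> are
  locally closed and hence untouched by opening.\<close>

lemma bopen_msubst_close:
  assumes "\<And>x. lc 0 (\<theta> x)" and "lc k M"
  shows "bopen (map \<eta> xs) k (msubst \<theta> (close xs k M)) =
    msubst (\<lambda>x. if x \<in> set xs then \<eta> x else \<theta> x) M"
  using assms(2)
proof (induction M arbitrary: k)
  case (FVar x)
  show ?case
  proof (cases "x \<in> set xs")
    case True
    then have "length (takeWhile (\<lambda>y. y \<noteq> x) xs) < length xs"
      by (induction xs) auto
    moreover from this have "xs ! length (takeWhile (\<lambda>y. y \<noteq> x) xs) = x"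
      using nth_length_takeWhile by blast
    ultimately show ?thesis
      using True by simp
  next
    case False
    have "lc k (\<theta> x)"
      using assms(1) lc_mono by blast
    with False show ?thesis
      by (simp add: bopen_lc)
  qed
qed simp_all

text \<open>The freshness hypothesis ensures that closing over the new names binds nothing that
  \<open>\<theta>\<close> has inserted.\<close>

lemma close_msubst:
  assumes "inj_on \<sigma> (set xs)" and "\<And>x. x \<in> fv M - set xs \<Longrightarrow> fv (\<theta> x) \<inter> \<sigma> ` set xs = {}"
  shows "close (map \<sigma> xs) k (msubst (\<lambda>x. if x \<in> set xs then FVar (\<sigma> x) else \<theta> x) M) =
    msubst \<theta> (close xs k M)"
  using assms(2)
proof (induction M arbitrary: k)
  case (FVar x)
  show ?case
  proof (cases "x \<in> set xs")
    case True
    then have "inj_on \<sigma> (insert x (set xs))"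
      using assms(1) by (simp add: insert_absorb)
    with True show ?thesis
      by (simp add: takeWhile_map_inj)
  next
    case False
    with FVar show ?thesis
      by (simp add: close_fresh)
  qed
qed auto

section \<open>Patterns and their values\<close>

lemma plug_cong: "(\<And>x. x \<in> set (vars p) \<Longrightarrow> \<theta> x = \<eta> x) \<Longrightarrow> plug \<theta> p = plug \<eta> p"
  by (induction p) auto

lemma msubst_plug: "msubst \<theta> (plug \<eta> p) = plug (\<lambda>x. msubst \<theta> (\<eta> x)) p"
  by (induction p) auto

lemma plug_map_pat: "plug \<theta> (map_pat \<sigma> p) = plug (\<lambda>x. \<theta> (\<sigma> x)) p"
  by (induction p) auto

lemma fv_plug: "fv (plug \<theta> p) = (\<Union>x\<in>set (vars p). fv (\<theta> x))"
  by (induction p) auto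

text \<open>Linearity makes the variables of the two halves of a pattern disjoint, so that the
  assignments found for them can be merged.\<close>

lemma is_value_plug:
  assumes "is_value ar p V" and "lin p"
  shows "\<exists>\<theta>. V = plug \<theta> p"
  using assms
proof (induction rule: is_value.induct)
  case (1 \<Delta> V x)
  show ?case by (rule exI[of _ "\<lambda>_. V"]) simp
next
  case (3 M x)
  show ?case by (rule exI[of _ "\<lambda>_. M"]) simp
next
  case (4 p V q W)
  then obtain \<theta> \<eta> where "V = plug \<theta> p" "W = plug \<eta> q"
    by (auto simp: lin_def)
  moreover have "plug \<theta> p = plug (\<lambda>x. if x \<in> set (vars p) then \<theta> x else \<eta> x) p"
    by (rule plug_cong) simp
  moreover have "plug \<eta> q = plug (\<lambda>x. if x \<in> set (vars p) then \<theta> x else \<eta> x) q"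
    using 4 by (intro plug_cong) (auto simp: lin_def)
  ultimately have "TPair V W = plug (\<lambda>x. if x \<in> set (vars p) then \<theta> x else \<eta> x) (PTensor p q)"
    by simp
  then show ?case by blast
next
  case (5 p V q W)
  then obtain \<theta> \<eta> where "V = plug \<theta> p" "W = plug \<eta> q"
    by (auto simp: lin_def)
  moreover have "plug \<theta> p = plug (\<lambda>x. if x \<in> set (vars p) then \<theta> x else \<eta> x) p"
    by (rule plug_cong) simp
  moreover have "plug \<eta> q = plug (\<lambda>x. if x \<in> set (vars p) then \<theta> x else \<eta> x) q"
    using 5 by (intro plug_cong) (auto simp: lin_def)
  ultimately have "WPair V W = plug (\<lambda>x. if x \<in> set (vars p) then \<theta> x else \<eta> x) (PWith p q)"
    by simp
  then show ?case by blast
qed simp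

text \<open>The variables of the pattern are not free in the value, so the later substitutions leave
  alone what the earlier ones have inserted. Sequential and simultaneous substitution thus
  agree.\<close>

lemma psubst_plug:
  assumes "lin p" and "set (vars p) \<inter> fv (plug \<theta> p) = {}"
  shows "psubst p (plug \<theta> p) M = msubst (\<lambda>x. if x \<in> set (vars p) then \<theta> x else FVar x) M"
  using assms
proof (induction p arbitrary: M)
  case (PTensor p q)
  let ?f = "\<lambda>p x. if x \<in> set (vars p) then \<theta> x else FVar x"
  have "psubst (PTensor p q) (plug \<theta> (PTensor p q)) M = msubst (?f q) (msubst (?f p) M)"
  proof -
    have "lin p" "lin q" "set (vars p) \<inter> fv (plug \<theta> p) = {}" "set (vars q) \<inter> fv (plug \<theta> q) = {}"
      using PTensor.prems by (auto simp: lin_def)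
    then show ?thesis
      by (simp only: plug.simps psubst.simps PTensor.IH)
  qed
  also have "\<dots> = msubst (?f (PTensor p q)) M"
    unfolding msubst_msubst
  proof (rule msubst_cong)
    fix x
    have "msubst (?f q) (\<theta> x) = msubst FVar (\<theta> x)" if "x \<in> set (vars p)"
      using PTensor.prems that by (intro msubst_cong) (auto simp: fv_plug)
    then show "msubst (?f q) (?f p x) = ?f (PTensor p q) x"
      by (simp add: msubst_FVar)
  qed
  finally show ?case .
next
  case (PWith p q)
  let ?f = "\<lambda>p x. if x \<in> set (vars p) then \<theta> x else FVar x"
  have "psubst (PWith p q) (plug \<theta> (PWith p q)) M = msubst (?f q) (msubst (?f p) M)"
  proof -
    have "lin p" "lin q" "set (vars p) \<inter> fv (plug \<theta> p) = {}" "set (vars q) \<inter> fv (plug \<theta> q) = {}"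
      using PWith.prems by (auto simp: lin_def)
    then show ?thesis
      by (simp only: plug.simps psubst.simps PWith.IH)
  qed
  also have "\<dots> = msubst (?f (PWith p q)) M"
    unfolding msubst_msubst
  proof (rule msubst_cong)
    fix x
    have "msubst (?f q) (\<theta> x) = msubst FVar (\<theta> x)" if "x \<in> set (vars p)"
      using PWith.prems that by (intro msubst_cong) (auto simp: fv_plug)
    then show "msubst (?f q) (?f p x) = ?f (PWith p q) x"
      by (simp add: msubst_FVar)
  qed
  finally show ?case .
qed (auto simp: subst_msubst msubst_FVar intro!: msubst_cong)

lemma ex_map_distinct:
  assumes "distinct xs" and "length xs = length ys"
  shows "\<exists>f. map f xs = ys"
  using assms(2,1)
proof (induction xs ys rule: list_induct2)
  case (Cons x xs y ys)
  then obtain f where "map f xs = ys" by auto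
  with Cons have "map (f(x := y)) (x # xs) = y # ys" by auto
  then show ?case by (rule exI[of _ "f(x := y)"])
qed simp

lemma same_shape_length: "map_pat f p = map_pat f q \<Longrightarrow> length (vars p) = length (vars q)"
  by (metis length_map vars_map_pat)

text \<open>Used to reassign a value, component by component, to another pattern for the same
  binder.\<close>

lemma plug_same_shape:
  "map_pat f p = map_pat f q \<Longrightarrow> map \<theta> (vars p) = map \<eta> (vars q) \<Longrightarrow> plug \<theta> p = plug \<eta> q"
proof (induction p arbitrary: q)
  case (PTensor p1 p2)
  then show ?case by (cases q) (auto dest: same_shape_length)
next
  case (PWith p1 p2)
  then show ?case by (cases q) (auto dest: same_shape_length)
next
  case (PVar x)
  then show ?case by (cases q) auto
next
  case (PBang x)
  then show ?case by (cases q) auto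
next
  case PUnit
  then show ?case by (cases q) auto
qed


section \<open>Joinable environments and refinement\<close>

text \<open>The condition under which two environments can be those of the premises of a
  multiplicative rule. A pattern without variables is joinable with everything, itself
  included.\<close>

definition joinable :: "var pat set \<Rightarrow> var pat set \<Rightarrow> bool" where
  "joinable \<Gamma> \<Delta> \<longleftrightarrow> (\<forall>p\<in>\<Gamma>. \<forall>q\<in>\<Delta>.
     set (vars p) \<inter> set (vars q) = {} \<or> (\<exists>x. p = PBang x \<and> q = PBang x))"

lemma joinable_simps [simp]:
  "joinable {} \<Delta>" "joinable \<Gamma> {}"
  "joinable (\<Gamma> \<union> \<Gamma>') \<Delta> \<longleftrightarrow> joinable \<Gamma> \<Delta> \<and> joinable \<Gamma>' \<Delta>"
  "joinable \<Gamma> (\<Delta> \<union> \<Delta>') \<longleftrightarrow> joinable \<Gamma> \<Delta> \<and> joinable \<Gamma> \<Delta>'"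
  "joinable (\<Union>i\<in>I. F i) \<Delta> \<longleftrightarrow> (\<forall>i\<in>I. joinable (F i) \<Delta>)"
  "joinable \<Gamma> (\<Union>i\<in>I. F i) \<longleftrightarrow> (\<forall>i\<in>I. joinable \<Gamma> (F i))"
  by (fastforce simp: joinable_def)+

lemma joinable_sym: "joinable \<Gamma> \<Delta> \<Longrightarrow> joinable \<Delta> \<Gamma>"
  unfolding joinable_def by blast

lemma separate_joinable: "\<Gamma> ## \<Delta> \<Longrightarrow> joinable \<Gamma> \<Delta>"
  unfolding joinable_def separate_def evars_def by blast

lemma joinable_exponential: "exponential \<Gamma> \<Longrightarrow> exponential \<Delta> \<Longrightarrow> joinable \<Gamma> \<Delta>"
  unfolding joinable_def exponential_def by fastforce

lemma env_Union:
  assumes "finite I" and "\<And>i. i \<in> I \<Longrightarrow> env (F i)"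
    and "\<And>i j. i \<in> I \<Longrightarrow> j \<in> I \<Longrightarrow> i \<noteq> j \<Longrightarrow> joinable (F i) (F j)"
  shows "env (\<Union>i\<in>I. F i)"
  using assms unfolding env_def joinable_def by (simp add: Ball_def) metis

lemma joinable_mult:
  assumes "exponential \<Gamma>1" "exponential \<Gamma>2" "\<Gamma>1 \<union> \<Gamma>2 ## \<Delta>1" "\<Gamma>1 \<union> \<Gamma>2 ## \<Delta>2" "\<Delta>1 ## \<Delta>2"
  shows "joinable (\<Gamma>1 \<union> \<Delta>1) (\<Gamma>2 \<union> \<Delta>2)"
proof -
  have "\<Gamma>1 ## \<Delta>2" "\<Delta>1 ## \<Gamma>2"
    using assms(3,4) unfolding separate_def evars_def by blast+
  then show ?thesis
    using assms joinable_exponential separate_joinable by simp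
qed

text \<open>All exponential patterns are put into the parts that may be shared. What remains on the
  two sides cannot overlap in a variable, because \<open>joinable\<close> permits overlap only at a
  common \<open>PBang x\<close>.\<close>

lemma mult_split:
  assumes "env E1" "env E2" "joinable E1 E2"
  obtains \<Gamma>1 \<Gamma>2 \<Delta>1 \<Delta>2 where "exponential \<Gamma>1" "exponential \<Gamma>2" "E1 = \<Gamma>1 \<union> \<Delta>1" "E2 = \<Gamma>2 \<union> \<Delta>2"
    "\<Gamma>1 \<union> \<Gamma>2 ## \<Delta>1" "\<Gamma>1 \<union> \<Gamma>2 ## \<Delta>2" "\<Delta>1 ## \<Delta>2" "E1 \<union> E2 = \<Gamma>1 \<union> \<Gamma>2 \<union> \<Delta>1 \<union> \<Delta>2"
proof
  let ?X = "{p. \<exists>x. p = PBang x}"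
  have 1: "E \<inter> ?X ## E - ?X" if "env E" for E
    using that unfolding env_def separate_def evars_def by blast
  have 2: "E \<inter> ?X ## E' - ?X" if "joinable E E'" for E E'
    using that unfolding joinable_def separate_def evars_def by blast
  have Un: "\<Gamma> \<union> \<Gamma>' ## \<Delta>" if "\<Gamma> ## \<Delta>" "\<Gamma>' ## \<Delta>" for \<Gamma> \<Gamma>' \<Delta>
    using that unfolding separate_def evars_def by blast
  show "exponential (E1 \<inter> ?X)" "exponential (E2 \<inter> ?X)"
    by (auto simp: exponential_def)
  show "E1 \<inter> ?X \<union> E2 \<inter> ?X ## E1 - ?X" "E1 \<inter> ?X \<union> E2 \<inter> ?X ## E2 - ?X"
    using 1 2 Un assms joinable_sym by blast+
  show "E1 - ?X ## E2 - ?X"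
    using assms(3) unfolding joinable_def separate_def evars_def by blast
qed auto

lemma typing_App:
  assumes "typing ar \<Gamma> M (A \<multimap> B)" "typing ar \<Delta> N A" "joinable \<Gamma> \<Delta>"
  shows "typing ar (\<Gamma> \<union> \<Delta>) (App M N) B"
  using mult_split[OF typing_env[OF assms(1)] typing_env[OF assms(2)] assms(3)]
  by (metis typing.app assms(1,2))

lemma typing_TPair:
  assumes "typing ar \<Gamma> M A" "typing ar \<Delta> N B" "joinable \<Gamma> \<Delta>"
  shows "typing ar (\<Gamma> \<union> \<Delta>) (TPair M N) (Tensor A B)"
  using mult_split[OF typing_env[OF assms(1)] typing_env[OF assms(2)] assms(3)]
  by (metis typing.tensorR assms(1,2))

text \<open>Defined by its effect on typability instead of as a closure of the left rules, which
  makes transitivity immediate. The context \<open>\<Delta>\<close> allows one premise of a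
  multiplicative rule to be refined while the other is kept, and preserving joinability lets the
  rule still be applied.\<close>

definition refines :: "('f \<Rightarrow> nat) \<Rightarrow> var pat set \<Rightarrow> var pat set \<Rightarrow> bool" where
  "refines ar \<Gamma> \<Gamma>' \<longleftrightarrow> (\<forall>\<Delta>. joinable \<Gamma> \<Delta> \<longrightarrow>
     joinable \<Gamma>' \<Delta> \<and> (\<forall>M A. typing ar (\<Gamma>' \<union> \<Delta>) M A \<longrightarrow> typing ar (\<Gamma> \<union> \<Delta>) M A))"

lemma refinesI:
  assumes "\<And>\<Delta>. joinable \<Gamma> \<Delta> \<Longrightarrow> joinable \<Gamma>' \<Delta>"
    and "\<And>\<Delta> M A. joinable \<Gamma> \<Delta> \<Longrightarrow> typing ar (\<Gamma>' \<union> \<Delta>) M A \<Longrightarrow> typing ar (\<Gamma> \<union> \<Delta>) M A"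
  shows "refines ar \<Gamma> \<Gamma>'"
  using assms unfolding refines_def by blast

lemma refines_joinable: "refines ar \<Gamma> \<Gamma>' \<Longrightarrow> joinable \<Gamma> \<Delta> \<Longrightarrow> joinable \<Gamma>' \<Delta>"
  unfolding refines_def by blast

lemma refines_typing_Un:
  "refines ar \<Gamma> \<Gamma>' \<Longrightarrow> joinable \<Gamma> \<Delta> \<Longrightarrow> typing ar (\<Gamma>' \<union> \<Delta>) M A \<Longrightarrow> typing ar (\<Gamma> \<union> \<Delta>) M A"
  unfolding refines_def by blast

lemma refines_typing: "refines ar \<Gamma> \<Gamma>' \<Longrightarrow> typing ar \<Gamma>' M A \<Longrightarrow> typing ar \<Gamma> M A"
  using refines_typing_Un[of ar \<Gamma> \<Gamma>' "{}"] by simp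

lemma refines_refl: "refines ar \<Gamma> \<Gamma>"
  unfolding refines_def by blast

lemma refines_trans: "refines ar \<Gamma> \<Gamma>' \<Longrightarrow> refines ar \<Gamma>' \<Gamma>'' \<Longrightarrow> refines ar \<Gamma> \<Gamma>''"
  unfolding refines_def by blast

lemma refines_Un:
  assumes "refines ar \<Gamma> \<Gamma>'" "refines ar \<Delta> \<Delta>'" "joinable \<Gamma> \<Delta>"
  shows "refines ar (\<Gamma> \<union> \<Delta>) (\<Gamma>' \<union> \<Delta>')"
proof (rule refinesI)
  fix \<Theta>
  assume "joinable (\<Gamma> \<union> \<Delta>) \<Theta>"
  then have j: "joinable \<Gamma> \<Theta>" "joinable \<Delta> \<Theta>" by simp_all
  then show "joinable (\<Gamma>' \<union> \<Delta>') \<Theta>"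
    using assms(1,2) by (simp add: refines_joinable)
  fix M A
  assume "typing ar (\<Gamma>' \<union> \<Delta>' \<union> \<Theta>) M A"
  then have "typing ar (\<Delta>' \<union> (\<Gamma>' \<union> \<Theta>)) M A"
    by (simp add: ac_simps)
  \<comment> \<open>\<open>\<Delta>'\<close> is undone first, with the still refined
    \<open>\<Gamma>'\<close> as part of its context; this is legitimate because refinement preserves
    joinability.\<close>
  moreover have "joinable \<Delta> (\<Gamma>' \<union> \<Theta>)"
    using assms(1,3) j refines_joinable joinable_sym by simp blast
  ultimately have "typing ar (\<Gamma>' \<union> (\<Delta> \<union> \<Theta>)) M A"
    using refines_typing_Un[OF assms(2)] by (metis Un_left_commute)
  then show "typing ar (\<Gamma> \<union> \<Delta> \<union> \<Theta>) M A"
    using refines_typing_Un[OF assms(1), of "\<Delta> \<union> \<Theta>"] assms(3) j by (simp add: ac_simps)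
qed

section \<open>The left rules as refinements\<close>

lemma refines_PBang:
  assumes "{PBang x} ## \<Delta>"
  shows "refines ar ({PBang x} \<union> \<Delta>) \<Delta>"
proof (rule refinesI)
  fix \<Theta> M A
  assume j: "joinable ({PBang x} \<union> \<Delta>) \<Theta>" and t: "typing ar (\<Delta> \<union> \<Theta>) M A"
  show "typing ar ({PBang x} \<union> \<Delta> \<union> \<Theta>) M A"
  \<comment> \<open>A joinable context may already contain the pattern, and then the union absorbs
    it. Otherwise joinability amounts to separation and weakening applies.\<close>
  proof (cases "PBang x \<in> \<Theta>")
    case True
    then have "{PBang x} \<union> \<Delta> \<union> \<Theta> = \<Delta> \<union> \<Theta>" by blast
    with t show ?thesis by simp
  next
    case False
    then have "{PBang x} ## \<Delta> \<union> \<Theta>"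
      using assms j by (fastforce simp: separate_def evars_def joinable_def)
    with t show ?thesis
      by (metis typing.weak Un_assoc)
  qed
qed (simp only: joinable_simps)

lemma refines_PUnit: "refines ar ({PUnit} \<union> \<Delta>) \<Delta>"
proof (rule refinesI)
  show "typing ar ({PUnit} \<union> \<Delta> \<union> \<Theta>) M A" if "typing ar (\<Delta> \<union> \<Theta>) M A" for \<Theta> M A
    using typing.unitL[OF that] by simp
qed (simp only: joinable_simps)

text \<open>Only a pattern \<open>PBang x\<close> may be shared between joinable environments; for
  any other \<open>p'\<close> joinability already means disjoint variables. This supplies the side
  conditions of the left rules in a larger context.\<close>

lemma separate_joinable_Un:
  assumes "{p} ## \<Delta>" "joinable {p'} \<Theta>" "set (vars p) \<subseteq> set (vars p')" "\<And>x. p' \<noteq> PBang x"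
  shows "{p} ## \<Delta> \<union> \<Theta>"
  using assms unfolding separate_def evars_def joinable_def by fastforce

lemma joinable_subset_vars:
  assumes "joinable {p} \<Theta>" "set (vars q) \<subseteq> set (vars p)" "\<And>x. p \<noteq> PBang x"
  shows "joinable {q} \<Theta>"
  using assms unfolding joinable_def by blast

lemma refines_PTensor:
  assumes "{p} ## {q}" "{p} ## \<Delta>" "{q} ## \<Delta>"
  shows "refines ar ({PTensor p q} \<union> \<Delta>) ({p} \<union> {q} \<union> \<Delta>)"
proof (rule refinesI)
  fix \<Theta>
  assume j: "joinable ({PTensor p q} \<union> \<Delta>) \<Theta>"
  then show "joinable ({p} \<union> {q} \<union> \<Delta>) \<Theta>"
    using joinable_subset_vars[of "PTensor p q" \<Theta>]
    unfolding joinable_simps by simp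
  have s: "{p} ## \<Delta> \<union> \<Theta>" "{q} ## \<Delta> \<union> \<Theta>"
    using j assms(2,3) separate_joinable_Un[of _ \<Delta> "PTensor p q" \<Theta>]
    unfolding joinable_simps by simp_all
  fix M A
  assume "typing ar ({p} \<union> {q} \<union> \<Delta> \<union> \<Theta>) M A"
  then show "typing ar ({PTensor p q} \<union> \<Delta> \<union> \<Theta>) M A"
    using typing.tensorL[OF _ assms(1) s] by (simp add: Un_assoc)
qed

lemma refines_PWith:
  assumes "lin (PWith p1 p2)" "{PWith p1 p2} ## \<Delta>" "p = p1 \<or> p = p2"
  shows "refines ar ({PWith p1 p2} \<union> \<Delta>) ({p} \<union> \<Delta>)"
proof (rule refinesI)
  fix \<Theta>
  assume j: "joinable ({PWith p1 p2} \<union> \<Delta>) \<Theta>"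
  then show "joinable ({p} \<union> \<Delta>) \<Theta>"
    using assms(3) joinable_subset_vars[of "PWith p1 p2" \<Theta>]
    unfolding joinable_simps by auto
  have s: "{PWith p1 p2} ## \<Delta> \<union> \<Theta>"
    using j assms(2) separate_joinable_Un[of _ \<Delta> "PWith p1 p2" \<Theta>]
    unfolding joinable_simps by simp
  fix M A
  assume "typing ar ({p} \<union> \<Delta> \<union> \<Theta>) M A"
  then show "typing ar ({PWith p1 p2} \<union> \<Delta> \<union> \<Theta>) M A"
    using typing.withL1[OF _ assms(1) s] typing.withL2[OF _ assms(1) s] assms(3)
    by (auto simp: Un_assoc)
qed

lemma refines_exponential:
  assumes "finite \<Gamma>" "exponential \<Gamma>"
  shows "refines ar \<Gamma> {}"
  using assms
proof (induction rule: finite_induct)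
  case (insert p \<Gamma>)
  then obtain x where "p = PBang x" and e: "exponential \<Gamma>"
    by (auto simp: exponential_def)
  have "{PBang x} ## \<Gamma>"
    using insert e \<open>p = PBang x\<close> by (fastforce simp: exponential_def separate_def evars_def)
  then have "refines ar (insert p \<Gamma>) \<Gamma>"
    using refines_PBang \<open>p = PBang x\<close> by fastforce
  with insert.IH[OF e] show ?case
    using refines_trans by blast
qed (rule refines_refl)

lemma refines_no_vars: "vars p = [] \<Longrightarrow> refines ar {p} {}"
proof (induction p)
  case PUnit
  then show ?case using refines_PUnit[of ar "{}"] by simp
next
  case (PTensor p q)
  then have "refines ar {PTensor p q} ({p} \<union> {q})"
    using refines_PTensor[of p q "{}"] by (simp add: separate_def evars_def)
  moreover have "refines ar ({p} \<union> {q}) ({} \<union> {})"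
    using PTensor by (intro refines_Un) (auto simp: joinable_def)
  ultimately show ?case
    using refines_trans by simp blast
next
  case (PWith p q)
  then have "refines ar {PWith p q} {p}"
    using refines_PWith[of p q "{}" p] by (simp add: separate_def evars_def lin_def)
  with PWith show ?case
    using refines_trans by simp blast
qed simp_all


section \<open>Inversion of typing up to refinement\<close>

text \<open>
  The typing of a variable and of \<open>WUnit\<close> is never inverted, hence the unconstrained
  environments in these cases.
\<close>

inductive right :: "('f \<Rightarrow> nat) \<Rightarrow> var pat set \<Rightarrow> 'f tm \<Rightarrow> ty \<Rightarrow> bool" for ar :: "'f \<Rightarrow> nat" where
  "right ar \<Gamma> (FVar x) A"
| "exponential \<Gamma> \<Longrightarrow> typing ar \<Gamma> M A \<Longrightarrow> right ar \<Gamma> (Bang M) (OfCourse A)"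
| "typing ar ({p} \<union> \<Delta>) M B \<Longrightarrow> {p} ## \<Delta> \<Longrightarrow> right ar \<Delta> (Lam p M) (pty p \<multimap> B)"
| "typing ar \<Gamma> M (A \<multimap> B) \<Longrightarrow> typing ar \<Delta> N A \<Longrightarrow> joinable \<Gamma> \<Delta> \<Longrightarrow> right ar (\<Gamma> \<union> \<Delta>) (App M N) B"
| "right ar {} TUnit One"
| "typing ar \<Gamma> M A \<Longrightarrow> typing ar \<Delta> N B \<Longrightarrow> joinable \<Gamma> \<Delta> \<Longrightarrow>
    right ar (\<Gamma> \<union> \<Delta>) (TPair M N) (Tensor A B)"
| "typing ar \<Delta> M A \<Longrightarrow> typing ar \<Delta> N B \<Longrightarrow> right ar \<Delta> (WPair M N) (With A B)"
| "right ar \<Delta> WUnit Top"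
| "right ar {} (Const r) TReal"
| "right ar \<Delta> (Const 0) TReal"
| "right ar {} (Sym f) (nest Tensor (replicate (ar f) (OfCourse TReal)) \<multimap> OfCourse TReal)"
| "right ar {} Plus (With TReal TReal \<multimap> TReal)"
| "right ar {} Times (TReal \<multimap> TReal \<multimap> TReal)"

inductive_cases right_BangE: "right ar \<Gamma> (Bang M) A"
inductive_cases right_AbsE: "right ar \<Gamma> (Abs s M) A"
inductive_cases right_AppE: "right ar \<Gamma> (App M N) A"
inductive_cases right_TUnitE: "right ar \<Gamma> TUnit A"
inductive_cases right_TPairE: "right ar \<Gamma> (TPair M N) A"
inductive_cases right_WPairE: "right ar \<Gamma> (WPair M N) A"
inductive_cases right_ConstE: "right ar \<Gamma> (Const r) A"
inductive_cases right_SymE: "right ar \<Gamma> (Sym f) A"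
inductive_cases right_PlusE: "right ar \<Gamma> Plus A"
inductive_cases right_TimesE: "right ar \<Gamma> Times A"

text \<open>Each left rule contributes one refinement, composed by transitivity; at a right rule or
  an axiom the refinement is reflexive.\<close>

lemma typing_right: "typing ar \<Gamma> M A \<Longrightarrow> \<exists>\<Gamma>'. refines ar \<Gamma> \<Gamma>' \<and> right ar \<Gamma>' M A"
proof (induction rule: typing.induct)
  case (weak \<Delta> M B x)
  then show ?case using refines_PBang refines_trans by blast
next
  case (unitL \<Delta> M B)
  then show ?case using refines_PUnit refines_trans by blast
next
  case (tensorL p q \<Delta> M C)
  then show ?case using refines_PTensor refines_trans by meson
next
  case (withL1 p \<Delta> M B q)
  then show ?case using refines_PWith[of p q \<Delta> p] refines_trans by meson
next
  case (withL2 q \<Delta> M B p)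
  then show ?case using refines_PWith[of p q \<Delta> q] refines_trans by meson
next
  case (app \<Gamma>1 \<Gamma>2 \<Delta>1 M A B \<Delta>2 N)
  then have "right ar ((\<Gamma>1 \<union> \<Delta>1) \<union> (\<Gamma>2 \<union> \<Delta>2)) (App M N) B"
    using joinable_mult right.intros(4) by blast
  then show ?case using refines_refl by (metis Un_assoc Un_left_commute)
next
  case (tensorR \<Gamma>1 \<Gamma>2 \<Delta>1 M A \<Delta>2 N B)
  then have "right ar ((\<Gamma>1 \<union> \<Delta>1) \<union> (\<Gamma>2 \<union> \<Delta>2)) (TPair M N) (Tensor A B)"
    using joinable_mult right.intros(6) by blast
  then show ?case using refines_refl by (metis Un_assoc Un_left_commute)
qed (blast intro: right.intros refines_refl)+

lemma typing_BangE:
  assumes "typing ar \<Gamma> (Bang M) C"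
  obtains \<Gamma>' A where "C = OfCourse A" "refines ar \<Gamma> \<Gamma>'" "exponential \<Gamma>'" "typing ar \<Gamma>' M A"
  \<comment> \<open>\<open>Lam\<close> is not a constructor, so \<open>Lam_def\<close> is unfolded
    to rule out the abstraction clause of \<open>right\<close>.\<close>
  using typing_right[OF assms] by (auto simp: Lam_def elim!: right_BangE)

text \<open>The pattern and the body come from the derivation, so their names may differ from those
  by which the abstraction was introduced.\<close>

lemma typing_AbsE:
  assumes "typing ar \<Gamma> (Abs s B) C"
  obtains \<Gamma>' p M D where "C = pty p \<multimap> D" "refines ar \<Gamma> \<Gamma>'" "Abs s B = Lam p M"
    "typing ar ({p} \<union> \<Gamma>') M D" "{p} ## \<Gamma>'"
  using typing_right[OF assms] by (auto elim!: right_AbsE)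

lemma typing_AppE:
  assumes "typing ar \<Gamma> (App M N) B"
  obtains \<Gamma>1 \<Gamma>2 A where "refines ar \<Gamma> (\<Gamma>1 \<union> \<Gamma>2)" "joinable \<Gamma>1 \<Gamma>2"
    "typing ar \<Gamma>1 M (A \<multimap> B)" "typing ar \<Gamma>2 N A"
  using typing_right[OF assms] by (auto simp: Lam_def elim!: right_AppE)

lemma typing_TPairE:
  assumes "typing ar \<Gamma> (TPair M N) C"
  obtains \<Gamma>1 \<Gamma>2 A B where "C = Tensor A B" "refines ar \<Gamma> (\<Gamma>1 \<union> \<Gamma>2)" "joinable \<Gamma>1 \<Gamma>2"
    "typing ar \<Gamma>1 M A" "typing ar \<Gamma>2 N B"
  using typing_right[OF assms] by (auto simp: Lam_def elim!: right_TPairE)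

text \<open>No refined environment remains here: both premises of \<open>withR\<close> use the
  environment of the conclusion, so the refinement can be undone in each of them.\<close>

lemma typing_WPairE:
  assumes "typing ar \<Gamma> (WPair M N) C"
  obtains A B where "C = With A B" "typing ar \<Gamma> M A" "typing ar \<Gamma> N B"
  using typing_right[OF assms] by (auto simp: Lam_def elim!: right_WPairE intro: refines_typing)

lemma typing_TUnitE:
  assumes "typing ar \<Gamma> TUnit C"
  shows "refines ar \<Gamma> {}"
  using typing_right[OF assms] by (auto simp: Lam_def elim!: right_TUnitE)

lemma typing_ConstE:
  assumes "typing ar \<Gamma> (Const r) C"
  shows "C = TReal \<and> (r = 0 \<or> refines ar \<Gamma> {})"
  using typing_right[OF assms] by (auto simp: Lam_def elim!: right_ConstE)

lemma typing_SymE: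
  assumes "typing ar \<Gamma> (Sym f) C"
  shows "C = nest Tensor (replicate (ar f) (OfCourse TReal)) \<multimap> OfCourse TReal \<and> refines ar \<Gamma> {}"
  using typing_right[OF assms] by (auto simp: Lam_def elim!: right_SymE)

lemma typing_PlusE:
  assumes "typing ar \<Gamma> Plus C"
  shows "C = With TReal TReal \<multimap> TReal \<and> refines ar \<Gamma> {}"
  using typing_right[OF assms] by (auto simp: Lam_def elim!: right_PlusE)

lemma typing_TimesE:
  assumes "typing ar \<Gamma> Times C"
  shows "C = TReal \<multimap> TReal \<multimap> TReal \<and> refines ar \<Gamma> {}"
  using typing_right[OF assms] by (auto simp: Lam_def elim!: right_TimesE)

lemma refines_Un_empty:
  "refines ar \<Gamma> {} \<Longrightarrow> refines ar \<Delta> {} \<Longrightarrow> joinable \<Gamma> \<Delta> \<Longrightarrow> refines ar (\<Gamma> \<union> \<Delta>) {}"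
  using refines_Un[of ar \<Gamma> "{}" \<Delta> "{}"] by simp


section \<open>The substitution lemma\<close>

definition normal :: "var pat \<Rightarrow> var pat set \<Rightarrow> bool" where
  "normal p \<Gamma> \<longleftrightarrow> (vars p = [] \<longrightarrow> \<Gamma> = {}) \<and> ((\<exists>x. p = PBang x) \<longrightarrow> exponential \<Gamma>)"

text \<open>
  Only patterns without variables and exponential patterns can be shared by the premises of
  a multiplicative rule, and normality makes their environments joinable with themselves.
\<close>

definition typed_family ::
    "('f \<Rightarrow> nat) \<Rightarrow> (var pat \<Rightarrow> var pat set) \<Rightarrow> (var \<Rightarrow> 'f tm) \<Rightarrow> var pat set \<Rightarrow> bool" where
  "typed_family ar G \<theta> E \<longleftrightarrow>
     (\<forall>p\<in>E. normal p (G p) \<and> typing ar (G p) (plug \<theta> p) (pty p)) \<and>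
     (\<forall>p\<in>E. \<forall>q\<in>E. p \<noteq> q \<longrightarrow> joinable (G p) (G q))"

lemma joinable_subset: "joinable \<Gamma> \<Delta> \<Longrightarrow> \<Delta>' \<subseteq> \<Delta> \<Longrightarrow> joinable \<Gamma> \<Delta>'"
  unfolding joinable_def by blast

text \<open>Environments are sets and \<open>##\<close> compares variables only, so in
  \<open>{p} \<union> \<Delta>\<close> the pattern \<open>p\<close> can already belong to
  \<open>\<Delta>\<close>. This isolates that degenerate case.\<close>

lemma separate_no_vars:
  assumes "{p} ## \<Delta>" "p \<in> \<Delta>"
  shows "vars p = []"
proof -
  have "set (vars p) \<inter> evars \<Delta> = {}"
    using assms(1) by (simp add: separate_def evars_def)
  moreover have "set (vars p) \<subseteq> evars \<Delta>"
    using assms(2) unfolding evars_def by (rule UN_upper)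
  ultimately have "set (vars p) = {}" by (simp add: Int_absorb2)
  then show ?thesis by simp
qed

lemma typing_plug_no_vars: "vars p = [] \<Longrightarrow> typing ar {} (plug \<theta> p) (pty p)"
proof (induction p)
  case (PTensor p q)
  then show ?case
    using typing_TPair[of ar "{}" "plug \<theta> p" "pty p" "{}"] by simp
qed (auto intro: typing.intros)

lemma refines_plug_no_vars:
  "vars p = [] \<Longrightarrow> typing ar \<Gamma> (plug \<theta> p) A \<Longrightarrow> refines ar \<Gamma> {}"
proof (induction p arbitrary: \<Gamma> A)
  case (PTensor p q)
  from PTensor.prems(2) obtain \<Gamma>1 \<Gamma>2 A' B where "refines ar \<Gamma> (\<Gamma>1 \<union> \<Gamma>2)" "joinable \<Gamma>1 \<Gamma>2"
      "typing ar \<Gamma>1 (plug \<theta> p) A'" "typing ar \<Gamma>2 (plug \<theta> q) B"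
    by (auto elim: typing_TPairE)
  moreover have "vars p = []" "vars q = []"
    using PTensor.prems(1) by simp_all
  ultimately show ?case
    using PTensor.IH refines_Un_empty refines_trans by meson
next
  case (PWith p q)
  then show ?case by (auto elim: typing_WPairE)
qed (auto intro: typing_TUnitE)

text \<open>A value for a pattern without variables is typable in the empty environment, and one for
  an exponential pattern is inverted to its promotion. For other patterns normality asks
  nothing.\<close>

lemma typing_normal:
  assumes "typing ar \<Gamma> (plug \<theta> p) (pty p)"
  obtains \<Gamma>' where "refines ar \<Gamma> \<Gamma>'" "normal p \<Gamma>'" "typing ar \<Gamma>' (plug \<theta> p) (pty p)"
proof (cases "vars p = []")
  case True
  then show ?thesis
    using that[of "{}"] refines_plug_no_vars[OF True assms] typing_plug_no_vars
    by (auto simp: normal_def exponential_def)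
next
  case nonempty: False
  show ?thesis
  proof (cases "\<exists>x. p = PBang x")
    case True
    then obtain x where p: "p = PBang x" by blast
    with assms obtain \<Gamma>' where "refines ar \<Gamma> \<Gamma>'" "exponential \<Gamma>'" "typing ar \<Gamma>' (\<theta> x) (snd x)"
      by (auto elim: typing_BangE)
    then show ?thesis
      using that[of \<Gamma>'] p by (auto simp: normal_def intro: typing.prom)
  next
    case False
    with nonempty show ?thesis
      using that[OF refines_refl _ assms] by (simp add: normal_def)
  qed
qed

section \<open>Families of environments indexed by patterns\<close>

lemma typed_family_subset: "typed_family ar G \<theta> E \<Longrightarrow> E' \<subseteq> E \<Longrightarrow> typed_family ar G \<theta> E'"
  unfolding typed_family_def by blast

lemma typed_family_joinable:
  assumes "typed_family ar G \<theta> ({p} \<union> \<Delta>)" and "p \<in> \<Delta> \<Longrightarrow> vars p = []"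
  shows "joinable (G p) (\<Union>q\<in>\<Delta>. G q)"
proof -
  have "joinable (G p) (G q)" if "q \<in> \<Delta>" for q
  proof (cases "p = q")
    case True
    with that assms have "G p = {}"
      by (auto simp: typed_family_def normal_def)
    then show ?thesis by simp
  next
    case False
    with that assms(1) show ?thesis by (auto simp: typed_family_def)
  qed
  then show ?thesis by simp
qed

lemma typed_family_env:
  assumes "typed_family ar G \<theta> E" "env E"
  shows "env (\<Union>p\<in>E. G p)"
  using assms by (intro env_Union) (auto simp: typed_family_def env_def[of E] dest: typing_env)

text \<open>A pattern on both sides either has no variables or is exponential, and normality then
  makes its environment joinable with itself.\<close>

lemma typed_family_share:
  assumes "typed_family ar G \<theta> (E1 \<union> E2)" and "joinable E1 E2"
  shows "joinable (\<Union>p\<in>E1. G p) (\<Union>q\<in>E2. G q)"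
proof -
  have "joinable (G p) (G q)" if "p \<in> E1" "q \<in> E2" for p q
  proof (cases "p = q")
    case True
    then have "vars p = [] \<or> (\<exists>x. p = PBang x)"
      using assms(2) that by (force simp: joinable_def)
    moreover have "normal p (G p)"
      using assms(1) that by (auto simp: typed_family_def)
    ultimately show ?thesis
      using True joinable_exponential by (auto simp: normal_def)
  next
    case False
    with assms(1) that show ?thesis by (auto simp: typed_family_def)
  qed
  then show ?thesis by simp
qed

text \<open>If \<open>p\<close> is already in \<open>E\<close>, it has no variables, so the old and
  the new environment are both empty by normality and nothing is overwritten.\<close>

lemma typed_family_update:
  assumes "typed_family ar G \<theta> E" and "normal p \<Gamma>" and "typing ar \<Gamma> (plug \<theta> p) (pty p)"
    and "joinable \<Gamma> (\<Union>q\<in>E. G q)" and "p \<in> E \<Longrightarrow> vars p = []"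
  shows "typed_family ar (G(p := \<Gamma>)) \<theta> ({p} \<union> E)"
    and "(\<Union>q\<in>{p} \<union> E. (G(p := \<Gamma>)) q) = \<Gamma> \<union> (\<Union>q\<in>E. G q)"
proof -
  have old: "(G(p := \<Gamma>)) q = G q" if "q \<in> E" for q
    using assms that by (auto simp: typed_family_def normal_def)
  have "joinable ((G(p := \<Gamma>)) q) ((G(p := \<Gamma>)) r)"
    if qr: "q \<in> {p} \<union> E" "r \<in> {p} \<union> E" "q \<noteq> r" for q r
  proof -
    consider "q = p" "r \<in> E" | "r = p" "q \<in> E" | "q \<in> E" "r \<in> E" "q \<noteq> r"
      using qr by auto
    then show ?thesis
    proof cases
      case 1
      then show ?thesis
        using assms(4) old[of r] by simp
    next
      case 2
      then show ?thesis
        using assms(4) old[of q] joinable_sym by simp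
    next
      case 3
      then show ?thesis
        using assms(1) old by (simp add: typed_family_def)
    qed
  qed
  moreover have "normal q ((G(p := \<Gamma>)) q) \<and> typing ar ((G(p := \<Gamma>)) q) (plug \<theta> q) (pty q)"
    if "q \<in> {p} \<union> E" for q
    using assms(1-3) that by (auto simp: typed_family_def)
  ultimately show "typed_family ar (G(p := \<Gamma>)) \<theta> ({p} \<union> E)"
    unfolding typed_family_def by blast
  have "(\<Union>q\<in>E. (G(p := \<Gamma>)) q) = (\<Union>q\<in>E. G q)"
    using old by (rule SUP_cong[OF refl])
  then show "(\<Union>q\<in>{p} \<union> E. (G(p := \<Gamma>)) q) = \<Gamma> \<union> (\<Union>q\<in>E. G q)"
    unfolding UN_Un by simp
qed

text \<open>The environment of \<open>p\<close> under the identity substitution. It would be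
  \<open>{p}\<close>, but normality demands the empty set for patterns without variables.\<close>

definition own :: "var pat \<Rightarrow> var pat set" where
  "own p = (if vars p = [] then {} else {p})"

lemma own_subset: "own p \<subseteq> {p}"
  by (simp add: own_def)

lemma normal_own: "normal p (own (map_pat \<sigma> p))"
  by (auto simp: normal_def own_def vars_map_pat exponential_def)

lemma refines_own: "refines ar {p} (own p)"
  by (simp add: own_def refines_no_vars refines_refl)

lemma refines_Union_own:
  assumes "env E"
  shows "refines ar E (\<Union>p\<in>E. own p)"
proof -
  have "finite E"
    using assms by (simp add: env_def)
  then show ?thesis
    using assms
  proof (induction rule: finite_induct)
    case (insert p E)
    then have "joinable {p} E"
      by (fastforce simp: env_def joinable_def)
    moreover have "env E"
      using insert.prems env_mono by blast
    ultimately show ?case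
      using refines_Un[OF refines_own insert.IH] by simp
  qed (simp add: refines_refl)
qed

text \<open>The identity axiom for composite patterns: a pattern, read as a term, is typed by
  itself.\<close>

lemma typing_plug_FVar: "lin p \<Longrightarrow> typing ar {p} (plug FVar p) (pty p)"
proof (induction p)
  case (PBang x)
  have "exponential {PBang x}"
    by (simp add: exponential_def)
  then show ?case
    using typing.der typing.prom by fastforce
next
  case PUnit
  then show ?case
    using typing.unitL[OF typing.unitR] by simp
next
  case (PTensor p q)
  then have "{p} ## {q}" and "typing ar {p} (plug FVar p) (pty p)"
    "typing ar {q} (plug FVar q) (pty q)"
    by (auto simp: lin_def separate_def evars_def)
  then have "typing ar ({p} \<union> {q}) (plug FVar (PTensor p q)) (pty (PTensor p q))"
    using typing_TPair separate_joinable by fastforce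
  then show ?case
    using typing.tensorL[of ar p q "{}"] \<open>{p} ## {q}\<close> by (simp add: separate_def evars_def)
next
  case (PWith p q)
  then have "typing ar {p} (plug FVar p) (pty p)"
    "typing ar {q} (plug FVar q) (pty q)"
    by (auto simp: lin_def)
  moreover have "{PWith p q} ## {}"
    by (simp add: separate_def evars_def)
  ultimately show ?case
    using typing.withL1[of ar p "{}" _ _ q] typing.withL2[of ar q "{}" _ _ p] PWith.prems
    by (simp add: typing.withR)
qed (simp add: typing.ax)

lemma typing_own: "lin p \<Longrightarrow> typing ar (own p) (plug FVar p) (pty p)"
  by (simp add: own_def typing_plug_no_vars typing_plug_FVar)

lemma typed_family_own:
  assumes "env E"
  shows "typed_family ar own FVar E"
proof -
  have "normal p (own p)" for p
    using normal_own[of p id] by (simp add: pat.map_id)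
  moreover have "joinable (own p) (own q)" if "p \<in> E" "q \<in> E" "p \<noteq> q" for p q
    using assms that by (auto simp: env_def joinable_def own_def)
  ultimately show ?thesis
    using assms by (auto simp: typed_family_def env_def intro: typing_own)
qed

lemma typed_family_cong:
  assumes "typed_family ar G \<theta> E" and "\<And>x. x \<in> evars E \<Longrightarrow> \<theta> x = \<eta> x"
  shows "typed_family ar G \<eta> E"
proof -
  have "plug \<eta> p = plug \<theta> p" if "p \<in> E" for p
    using assms(2) that unfolding evars_def by (intro plug_cong) (metis UN_I)
  with assms(1) show ?thesis
    by (simp add: typed_family_def)
qed

lemma pty_map_pat: "(\<And>x. snd (\<sigma> x) = snd x) \<Longrightarrow> pty (map_pat \<sigma> p) = pty p"
  by (induction p) auto

lemma fresh_renaming: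
  fixes S :: "var set"
  assumes "finite S"
  obtains \<sigma> :: "var \<Rightarrow> var" where "inj \<sigma>" "\<And>x. snd (\<sigma> x) = snd x" "range \<sigma> \<inter> S = {}"
proof -
  \<comment> \<open>Shifting every name by more than the largest name in \<open>S\<close> leaves
    \<open>S\<close>; the inserted \<open>0\<close> keeps \<open>Max\<close> meaningful for empty
    \<open>S\<close>.\<close>
  define k where "k = Suc (Max (insert 0 (fst ` S)))"
  have "n < k" if "(n, t) \<in> S" for n t
  proof -
    have "n \<in> insert 0 (fst ` S)"
      using that by force
    then have "n \<le> Max (insert 0 (fst ` S))"
      using assms by (intro Max_ge) auto
    then show ?thesis
      by (simp add: k_def)
  qed
  then have "range (\<lambda>x. (fst x + k, snd x)) \<inter> S = {}"
    by fastforce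
  then show ?thesis
    using that[of "\<lambda>x. (fst x + k, snd x)"] by (simp add: inj_def prod_eq_iff)
qed

lemma msubst_Lam:
  assumes "inj \<sigma>" and "\<And>x. snd (\<sigma> x) = snd x"
    and "\<And>x. x \<in> fv M \<Longrightarrow> fv (\<theta> x) \<inter> range \<sigma> = {}"
  shows "msubst \<theta> (Lam p M) =
    Lam (map_pat \<sigma> p) (msubst (\<lambda>x. if x \<in> set (vars p) then FVar (\<sigma> x) else \<theta> x) M)"
proof -
  have "snd \<circ> \<sigma> = snd"
    using assms(2) by auto
  moreover have "close (map \<sigma> (vars p)) 0 (msubst (\<lambda>x. if x \<in> set (vars p) then FVar (\<sigma> x) else \<theta> x) M) =
      msubst \<theta> (close (vars p) 0 M)"
  proof (rule close_msubst)
    show "inj_on \<sigma> (set (vars p))"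
      using assms(1) by (rule inj_on_subset) simp
    show "fv (\<theta> x) \<inter> \<sigma> ` set (vars p) = {}" if "x \<in> fv M - set (vars p)" for x
      using assms(3)[of x] that by blast
  qed
  ultimately show ?thesis
    by (simp add: Lam_def vars_map_pat pat.map_comp)
qed

text \<open>Common core of the two additive left rules: the chosen component inherits the whole
  environment of the pair.\<close>

lemma typed_family_replace:
  assumes "typed_family ar G \<theta> ({p} \<union> \<Delta>)" "{p} ## \<Delta>" "{q} ## \<Delta>"
    and "typing ar (G p) (plug \<theta> q) (pty q)"
    and "\<And>G. typed_family ar G \<theta> ({q} \<union> \<Delta>) \<Longrightarrow> typing ar (\<Union>r\<in>{q} \<union> \<Delta>. G r) M B"
  shows "typing ar (\<Union>r\<in>{p} \<union> \<Delta>. G r) M B"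
proof -
  have fam: "typed_family ar G \<theta> \<Delta>"
    using typed_family_subset[OF assms(1)] by blast
  have j: "joinable (G p) (\<Union>r\<in>\<Delta>. G r)"
    using typed_family_joinable[OF assms(1)] separate_no_vars[OF assms(2)] by blast
  obtain \<Gamma> where \<Gamma>: "refines ar (G p) \<Gamma>" "normal q \<Gamma>" "typing ar \<Gamma> (plug \<theta> q) (pty q)"
    using typing_normal[OF assms(4)] .
  have "typed_family ar (G(q := \<Gamma>)) \<theta> ({q} \<union> \<Delta>)"
    "(\<Union>r\<in>{q} \<union> \<Delta>. (G(q := \<Gamma>)) r) = \<Gamma> \<union> (\<Union>r\<in>\<Delta>. G r)"
    using typed_family_update[OF fam \<Gamma>(2,3) refines_joinable[OF \<Gamma>(1) j]]
      separate_no_vars[OF assms(3)] by blast+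
  then have "typing ar (\<Gamma> \<union> (\<Union>r\<in>\<Delta>. G r)) M B"
    using assms(5) by metis
  then have "typing ar (G p \<union> (\<Union>r\<in>\<Delta>. G r)) M B"
    by (rule refines_typing_Un[OF \<Gamma>(1) j])
  then show ?thesis by simp
qed

lemma typing_msubst:
  assumes "typing ar E M B" and "typed_family ar G \<theta> E"
  shows "typing ar (\<Union>p\<in>E. G p) (msubst \<theta> M) B"
  using assms
proof (induction arbitrary: G \<theta> rule: typing.induct)
  case (ax x)
  then show ?case by (simp add: typed_family_def)
next
  case (der x)
  then have "typing ar (G (PBang x)) (Bang (\<theta> x)) (OfCourse (snd x))"
    by (simp add: typed_family_def)
  then show ?case
    by (auto elim!: typing_BangE intro: refines_typing)
next
  case (prom \<Gamma> M A)
  \<comment> \<open>By normality the values for exponential patterns live in exponential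
    environments, so promotion can be applied again.\<close>
  then have "\<forall>p\<in>\<Gamma>. exponential (G p)"
    by (auto simp: typed_family_def normal_def exponential_def[of \<Gamma>])
  then have "exponential (\<Union>p\<in>\<Gamma>. G p)"
    by (auto simp: exponential_def)
  with prom show ?case by (auto intro: typing.prom)
next
  case (weak \<Delta> M B x)
  have "PBang x \<notin> \<Delta>"
    using separate_no_vars[OF weak.hyps(2)] by auto
  then have "joinable (G (PBang x)) (\<Union>p\<in>\<Delta>. G p)"
    using typed_family_joinable[OF weak.prems] by blast
  moreover have "typing ar ({} \<union> (\<Union>p\<in>\<Delta>. G p)) (msubst \<theta> M) B"
    using weak.IH[OF typed_family_subset[OF weak.prems]] by auto
  \<comment> \<open>The value for \<open>x\<close> is dropped. Its environment is exponential by
    normality and is restored by weakening.\<close>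
  moreover have "env (G (PBang x))" "exponential (G (PBang x))"
    using weak.prems typing_env by (auto simp: typed_family_def normal_def)
  ultimately have "typing ar (G (PBang x) \<union> (\<Union>p\<in>\<Delta>. G p)) (msubst \<theta> M) B"
    using refines_typing_Un refines_exponential by (metis env_def)
  then show ?case by simp
next
  case (lam p \<Delta> M B)
  \<comment> \<open>The new bound names must avoid the resulting environment, for the side condition
    of \<open>typing.lam\<close>, and the inserted terms, against capture.\<close>
  define S where "S = evars (\<Union>q\<in>\<Delta>. G q) \<union> (\<Union>x\<in>fv M. fv (\<theta> x))"
  have envs: "env ({p} \<union> \<Delta>)"
    using lam.hyps(1) typing_env by blast
  then have "env \<Delta>"
    using env_mono by blast
  then have "finite (\<Union>q\<in>\<Delta>. G q)"
    using typed_family_env[OF lam.prems] by (simp add: env_def)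
  then have "finite S"
    by (simp add: S_def evars_def[of "\<Union> _"] finite_fv del: UN_UN_flatten UN_simps)
  obtain \<sigma> :: "var \<Rightarrow> var" where \<sigma>: "inj \<sigma>" "\<And>x. snd (\<sigma> x) = snd x" "range \<sigma> \<inter> S = {}"
    using fresh_renaming[OF \<open>finite S\<close>] by metis
  define p' where "p' = map_pat \<sigma> p"
  define \<eta> where "\<eta> = (\<lambda>x. if x \<in> set (vars p) then FVar (\<sigma> x) else \<theta> x)"
  have "lin p"
    using envs by (simp add: env_def)
  then have "lin p'"
    using \<sigma>(1) by (auto simp: p'_def lin_def vars_map_pat distinct_map intro: inj_on_subset)
  have "plug \<eta> p = plug FVar p'"
    by (auto simp: p'_def plug_map_pat \<eta>_def intro: plug_cong)
  then have own: "typing ar (own p') (plug \<eta> p) (pty p)"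
    using typing_own[OF \<open>lin p'\<close>] by (simp add: p'_def pty_map_pat \<sigma>(2))
  have "{p'} ## (\<Union>q\<in>\<Delta>. G q)"
    using \<sigma>(3) by (auto simp: separate_def S_def p'_def vars_map_pat evars_def)
  then have j: "joinable {p'} (\<Union>q\<in>\<Delta>. G q)"
    by (rule separate_joinable)
  then have "joinable (own p') (\<Union>q\<in>\<Delta>. G q)"
    by (meson joinable_sym joinable_subset own_subset)
  moreover have "typed_family ar G \<eta> \<Delta>"
    using lam.hyps(2) by (intro typed_family_cong[OF lam.prems]) (auto simp: \<eta>_def separate_def evars_def)
  ultimately have "typed_family ar (G(p := own p')) \<eta> ({p} \<union> \<Delta>)"
    "(\<Union>q\<in>{p} \<union> \<Delta>. (G(p := own p')) q) = own p' \<union> (\<Union>q\<in>\<Delta>. G q)"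
    using typed_family_update[of ar G \<eta> \<Delta> p "own p'"] own normal_own
      separate_no_vars[OF lam.hyps(2)] unfolding p'_def by blast+
  then have "typing ar (own p' \<union> (\<Union>q\<in>\<Delta>. G q)) (msubst \<eta> M) B"
    using lam.IH by metis
  \<comment> \<open>\<open>own p'\<close> and \<open>{p'}\<close> differ only if \<open>p'\<close>
    has no variables; \<open>typing.lam\<close> needs the pattern to be present.\<close>
  then have "typing ar ({p'} \<union> (\<Union>q\<in>\<Delta>. G q)) (msubst \<eta> M) B"
    by (rule refines_typing_Un[OF refines_own j])
  then have "typing ar (\<Union>q\<in>\<Delta>. G q) (Lam p' (msubst \<eta> M)) (pty p' \<multimap> B)"
    using \<open>{p'} ## (\<Union>q\<in>\<Delta>. G q)\<close> by (rule typing.lam)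
  moreover have "msubst \<theta> (Lam p M) = Lam p' (msubst \<eta> M)"
    unfolding p'_def \<eta>_def using \<sigma>(3) by (intro msubst_Lam \<sigma>(1,2)) (auto simp: S_def)
  moreover have "pty p' = pty p"
    by (simp add: p'_def pty_map_pat \<sigma>(2))
  ultimately show ?case by simp
next
  case (app \<Gamma>1 \<Gamma>2 \<Delta>1 M A B \<Delta>2 N)
  have E: "(\<Gamma>1 \<union> \<Delta>1) \<union> (\<Gamma>2 \<union> \<Delta>2) = \<Gamma>1 \<union> \<Gamma>2 \<union> \<Delta>1 \<union> \<Delta>2" by blast
  have fam: "typed_family ar G \<theta> ((\<Gamma>1 \<union> \<Delta>1) \<union> (\<Gamma>2 \<union> \<Delta>2))"
    using app.prems E by simp
  have "typing ar (\<Union>p\<in>\<Gamma>1 \<union> \<Delta>1. G p) (msubst \<theta> M) (A \<multimap> B)"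
    "typing ar (\<Union>p\<in>\<Gamma>2 \<union> \<Delta>2. G p) (msubst \<theta> N) A"
    using app.IH typed_family_subset[OF fam] by blast+
  moreover have "joinable (\<Union>p\<in>\<Gamma>1 \<union> \<Delta>1. G p) (\<Union>p\<in>\<Gamma>2 \<union> \<Delta>2. G p)"
    using app.hyps joinable_mult by (intro typed_family_share[OF fam]) blast
  ultimately show ?case
    unfolding E[symmetric] UN_Un by (simp only: msubst.simps typing_App)
next
  case (tensorR \<Gamma>1 \<Gamma>2 \<Delta>1 M A \<Delta>2 N B)
  have E: "(\<Gamma>1 \<union> \<Delta>1) \<union> (\<Gamma>2 \<union> \<Delta>2) = \<Gamma>1 \<union> \<Gamma>2 \<union> \<Delta>1 \<union> \<Delta>2" by blast
  have fam: "typed_family ar G \<theta> ((\<Gamma>1 \<union> \<Delta>1) \<union> (\<Gamma>2 \<union> \<Delta>2))"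
    using tensorR.prems E by simp
  have "typing ar (\<Union>p\<in>\<Gamma>1 \<union> \<Delta>1. G p) (msubst \<theta> M) A"
    "typing ar (\<Union>p\<in>\<Gamma>2 \<union> \<Delta>2. G p) (msubst \<theta> N) B"
    using tensorR.IH typed_family_subset[OF fam] by blast+
  moreover have "joinable (\<Union>p\<in>\<Gamma>1 \<union> \<Delta>1. G p) (\<Union>p\<in>\<Gamma>2 \<union> \<Delta>2. G p)"
    using tensorR.hyps joinable_mult by (intro typed_family_share[OF fam]) blast
  ultimately show ?case
    unfolding E[symmetric] UN_Un by (simp only: msubst.simps typing_TPair)
next
  case (unitL \<Delta> M B)
  have "typing ar (\<Union>p\<in>\<Delta>. G p) (msubst \<theta> M) B"
    using unitL.IH[OF typed_family_subset[OF unitL.prems]] by auto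
  moreover have "G PUnit = {}"
    using unitL.prems by (simp add: typed_family_def normal_def)
  ultimately show ?case by simp
next
  case (tensorL p q \<Delta> M C)
  have fam: "typed_family ar G \<theta> \<Delta>"
    using typed_family_subset[OF tensorL.prems] by blast
  have "{PTensor p q} ## \<Delta>"
    using tensorL.hyps by (auto simp: separate_def evars_def)
  then have j: "joinable (G (PTensor p q)) (\<Union>r\<in>\<Delta>. G r)"
    using typed_family_joinable[OF tensorL.prems] separate_no_vars by blast
  have "typing ar (G (PTensor p q)) (TPair (plug \<theta> p) (plug \<theta> q)) (Tensor (pty p) (pty q))"
    using tensorL.prems by (simp add: typed_family_def)
  then obtain \<Gamma>1 \<Gamma>2 where \<Gamma>: "refines ar (G (PTensor p q)) (\<Gamma>1 \<union> \<Gamma>2)" "joinable \<Gamma>1 \<Gamma>2"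
      "typing ar \<Gamma>1 (plug \<theta> p) (pty p)" "typing ar \<Gamma>2 (plug \<theta> q) (pty q)"
    by (auto elim: typing_TPairE)
  obtain \<Gamma>1' where \<Gamma>1': "refines ar \<Gamma>1 \<Gamma>1'" "normal p \<Gamma>1'" "typing ar \<Gamma>1' (plug \<theta> p) (pty p)"
    using typing_normal[OF \<Gamma>(3)] .
  obtain \<Gamma>2' where \<Gamma>2': "refines ar \<Gamma>2 \<Gamma>2'" "normal q \<Gamma>2'" "typing ar \<Gamma>2' (plug \<theta> q) (pty q)"
    using typing_normal[OF \<Gamma>(4)] .
  have ref: "refines ar (G (PTensor p q)) (\<Gamma>1' \<union> \<Gamma>2')"
    using refines_trans[OF \<Gamma>(1) refines_Un[OF \<Gamma>1'(1) \<Gamma>2'(1) \<Gamma>(2)]] .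
  have "joinable (\<Gamma>1' \<union> \<Gamma>2') (\<Union>r\<in>\<Delta>. G r)"
    using refines_joinable[OF ref j] .
  then have j12: "joinable \<Gamma>1' (\<Union>r\<in>\<Delta>. G r)" "joinable \<Gamma>2' (\<Union>r\<in>\<Delta>. G r)"
    unfolding joinable_simps by blast+
  \<comment> \<open>The environment of the pair is divided: \<open>\<Gamma>2'\<close> goes to
    \<open>q\<close>, then \<open>\<Gamma>1'\<close> to \<open>p\<close>. Either pattern may already
    be present, but only without variables.\<close>
  define G2 where "G2 = G(q := \<Gamma>2')"
  have G2: "typed_family ar G2 \<theta> ({q} \<union> \<Delta>)" "(\<Union>r\<in>{q} \<union> \<Delta>. G2 r) = \<Gamma>2' \<union> (\<Union>r\<in>\<Delta>. G r)"
    using typed_family_update[OF fam \<Gamma>2'(2,3) j12(2)] separate_no_vars[OF tensorL.hyps(4)]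
    unfolding G2_def by blast+
  have "joinable \<Gamma>1' \<Gamma>2'"
    using refines_joinable[OF \<Gamma>1'(1)] refines_joinable[OF \<Gamma>2'(1)] \<Gamma>(2) joinable_sym by blast
  then have jG2: "joinable \<Gamma>1' (\<Union>r\<in>{q} \<union> \<Delta>. G2 r)"
    unfolding G2(2) using j12(1) by (simp only: joinable_simps)
  have no_vars: "vars p = []" if "p \<in> {q} \<union> \<Delta>"
    using that separate_no_vars[OF tensorL.hyps(2)] separate_no_vars[OF tensorL.hyps(3)] by auto
  have upd: "typed_family ar (G2(p := \<Gamma>1')) \<theta> ({p} \<union> ({q} \<union> \<Delta>))"
    "(\<Union>r\<in>{p} \<union> ({q} \<union> \<Delta>). (G2(p := \<Gamma>1')) r) = \<Gamma>1' \<union> (\<Union>r\<in>{q} \<union> \<Delta>. G2 r)"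
    by (rule typed_family_update[OF G2(1) \<Gamma>1'(2,3) jG2], erule no_vars)+
  have "typing ar (\<Union>r\<in>{p} \<union> ({q} \<union> \<Delta>). (G2(p := \<Gamma>1')) r) (msubst \<theta> M) C"
    using tensorL.IH[of "G2(p := \<Gamma>1')" \<theta>] upd(1) unfolding Un_assoc by blast
  then have "typing ar (\<Gamma>1' \<union> \<Gamma>2' \<union> (\<Union>r\<in>\<Delta>. G r)) (msubst \<theta> M) C"
    unfolding upd(2) G2(2) by (simp only: Un_assoc)
  then have "typing ar (G (PTensor p q) \<union> (\<Union>r\<in>\<Delta>. G r)) (msubst \<theta> M) C"
    by (rule refines_typing_Un[OF ref j])
  then show ?case by simp
next
  case (withL1 p \<Delta> M B q)
  have "typing ar (G (PWith p q)) (WPair (plug \<theta> p) (plug \<theta> q)) (With (pty p) (pty q))"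
    using withL1.prems by (simp add: typed_family_def)
  then have t: "typing ar (G (PWith p q)) (plug \<theta> p) (pty p)"
    by (auto elim: typing_WPairE)
  have "{p} ## \<Delta>"
    using withL1.hyps(3) by (auto simp: separate_def evars_def)
  show ?case
    using typed_family_replace[OF withL1.prems withL1.hyps(3) \<open>{p} ## \<Delta>\<close> t withL1.IH] .
next
  case (withL2 q \<Delta> M B p)
  have "typing ar (G (PWith p q)) (WPair (plug \<theta> p) (plug \<theta> q)) (With (pty p) (pty q))"
    using withL2.prems by (simp add: typed_family_def)
  then have t: "typing ar (G (PWith p q)) (plug \<theta> q) (pty q)"
    by (auto elim: typing_WPairE)
  have "{q} ## \<Delta>"
    using withL2.hyps(3) by (auto simp: separate_def evars_def)
  show ?case
    using typed_family_replace[OF withL2.prems withL2.hyps(3) \<open>{q} ## \<Delta>\<close> t withL2.IH] .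
next
  case (topR \<Delta>)
  then show ?case by (auto intro: typing.topR typed_family_env)
next
  case (zero \<Delta>)
  then show ?case by (auto intro: typing.zero typed_family_env)
qed (auto intro: typing.intros)


section \<open>Subject reduction\<close>

lemma fv_Lam: "fv (Lam p M) = fv M - set (vars p)"
  by (simp add: Lam_def fv_close)

text \<open>Needed under an abstraction: names that are fresh for the redex remain fresh for its
  reduct.\<close>

lemma fv_red: "red ar den M N \<Longrightarrow> fv N \<subseteq> fv M"
proof (induction rule: red.induct)
  case (beta p M V)
  then obtain \<theta> where V: "V = plug \<theta> p"
    using is_value_plug by blast
  have "psubst p V M = msubst (\<lambda>x. if x \<in> set (vars p) then \<theta> x else FVar x) M"
    using psubst_plug beta V by blast
  then show ?case
    using V by (auto simp: fv_msubst fv_Lam fv_plug split: if_splits)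
qed (auto simp: fv_Lam)

text \<open>The derivation supplies its own pattern \<open>q\<close> for the abstraction. The value
  is reassigned to \<open>q\<close> and the substitution lemma is applied there, sending each
  variable of \<open>\<Gamma>1'\<close> to itself.\<close>

lemma typing_beta:
  assumes "lin p" "is_term M" "\<And>x. lc 0 (\<theta> x)"
    and "typing ar \<Gamma> (App (msubst \<theta> (Lam p M)) (plug \<eta> p)) B"
  shows "typing ar \<Gamma> (msubst (\<lambda>x. if x \<in> set (vars p) then \<eta> x else \<theta> x) M) B"
proof -
  from assms(4) obtain \<Gamma>1 \<Gamma>2 A where \<Gamma>: "refines ar \<Gamma> (\<Gamma>1 \<union> \<Gamma>2)" "joinable \<Gamma>1 \<Gamma>2"
      "typing ar \<Gamma>1 (Abs (map_pat snd p) (msubst \<theta> (close (vars p) 0 M))) (A \<multimap> B)"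
      "typing ar \<Gamma>2 (plug \<eta> p) A"
    by (auto simp: Lam_def elim: typing_AppE)
  from \<Gamma>(3) obtain \<Gamma>1' q L where \<Gamma>1': "A = pty q" "refines ar \<Gamma>1 \<Gamma>1'"
      "Abs (map_pat snd p) (msubst \<theta> (close (vars p) 0 M)) = Lam q L"
      "typing ar ({q} \<union> \<Gamma>1') L B" "{q} ## \<Gamma>1'"
    by (auto elim: typing_AbsE)
  then have shape: "map_pat snd q = map_pat snd p"
    and body: "close (vars q) 0 L = msubst \<theta> (close (vars p) 0 M)"
    by (simp_all add: Lam_def)
  have envq: "env ({q} \<union> \<Gamma>1')"
    using \<Gamma>1'(4) typing_env by blast
  then have "env \<Gamma>1'"
    using env_mono by blast
  have "lin q"
    using envq by (simp add: env_def)
  \<comment> \<open>The components are transferred from \<open>p\<close> to \<open>q\<close> by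
    position, which is well defined as the variables of \<open>q\<close> are distinct.\<close>
  then obtain \<eta>' where \<eta>': "map \<eta>' (vars q) = map \<eta> (vars p)"
    using ex_map_distinct[of "vars q" "map \<eta> (vars p)"] same_shape_length[OF shape]
    by (auto simp: lin_def)
  then have "plug \<eta>' q = plug \<eta> p"
    using plug_same_shape[OF shape] by blast
  then have "typing ar \<Gamma>2 (plug \<eta>' q) (pty q)"
    using \<Gamma>(4) \<Gamma>1'(1) by simp
  then obtain \<Gamma>2' where \<Gamma>2': "refines ar \<Gamma>2 \<Gamma>2'" "normal q \<Gamma>2'"
      "typing ar \<Gamma>2' (plug \<eta>' q) (pty q)"
    using typing_normal by blast
  define \<theta>' where "\<theta>' = (\<lambda>x. if x \<in> set (vars q) then \<eta>' x else FVar x)"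
  have fam: "typed_family ar own \<theta>' \<Gamma>1'"
    using \<Gamma>1'(5) by (intro typed_family_cong[OF typed_family_own[OF \<open>env \<Gamma>1'\<close>]])
      (auto simp: \<theta>'_def separate_def evars_def)
  have plug': "plug \<theta>' q = plug \<eta>' q"
    by (rule plug_cong) (simp add: \<theta>'_def)
  have ref1: "refines ar \<Gamma>1 (\<Union>r\<in>\<Gamma>1'. own r)"
    using refines_trans[OF \<Gamma>1'(2) refines_Union_own[OF \<open>env \<Gamma>1'\<close>]] .
  have ref: "refines ar \<Gamma> ((\<Union>r\<in>\<Gamma>1'. own r) \<union> \<Gamma>2')"
    using refines_trans[OF \<Gamma>(1) refines_Un[OF ref1 \<Gamma>2'(1) \<Gamma>(2)]] .
  have "joinable \<Gamma>2' (\<Union>r\<in>\<Gamma>1'. own r)"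
    using refines_joinable[OF ref1] refines_joinable[OF \<Gamma>2'(1)] \<Gamma>(2) joinable_sym by blast
  then have "typed_family ar (own(q := \<Gamma>2')) \<theta>' ({q} \<union> \<Gamma>1')"
    "(\<Union>r\<in>{q} \<union> \<Gamma>1'. (own(q := \<Gamma>2')) r) = \<Gamma>2' \<union> (\<Union>r\<in>\<Gamma>1'. own r)"
    using typed_family_update[OF fam \<Gamma>2'(2)] \<Gamma>2'(3) separate_no_vars[OF \<Gamma>1'(5)]
    unfolding plug' by blast+
  then have "typing ar ((\<Union>r\<in>\<Gamma>1'. own r) \<union> \<Gamma>2') (msubst \<theta>' L) B"
    using typing_msubst[OF \<Gamma>1'(4)] by (metis Un_commute)
  then have "typing ar \<Gamma> (msubst \<theta>' L) B"
    by (rule refines_typing[OF ref])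
  \<comment> \<open>The closed body of \<open>L\<close> is that of \<open>M\<close> after
    \<open>\<theta>\<close>. Opening both with the same list of components identifies the two
    results.\<close>
  moreover have "msubst \<theta>' L = bopen (map \<eta>' (vars q)) 0 (close (vars q) 0 L)"
    using bopen_msubst_close[of FVar 0 L \<eta>' "vars q"] typing_is_term[OF \<Gamma>1'(4)]
    by (simp add: msubst_FVar \<theta>'_def is_term_lc)
  moreover have "\<dots> = msubst (\<lambda>x. if x \<in> set (vars p) then \<eta> x else \<theta> x) M"
    unfolding \<eta>' body using assms(2,3) by (intro bopen_msubst_close) (simp_all add: is_term_lc)
  ultimately show ?thesis by simp
qed

text \<open>
  A scalar \<open>0\<close> is typed in every environment, but below a promotion the environment is
  exponential.
\<close>

lemma refines_nest_Bang_Const: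
  "typing ar \<Gamma> (nest TPair (map (\<lambda>r. Bang (Const r)) rs)) A \<Longrightarrow> rs \<noteq> [] \<Longrightarrow> refines ar \<Gamma> {}"
proof (induction rs arbitrary: \<Gamma> A rule: induct_list012)
  case (2 r)
  then obtain \<Gamma>' B where "refines ar \<Gamma> \<Gamma>'" "exponential \<Gamma>'" "typing ar \<Gamma>' (Const r) B"
    by (auto elim: typing_BangE)
  then show ?case
    using typing_env refines_exponential refines_trans by (metis env_def)
next
  case (3 r s rs)
  then obtain \<Gamma>1 \<Gamma>2 B C where \<Gamma>: "refines ar \<Gamma> (\<Gamma>1 \<union> \<Gamma>2)" "joinable \<Gamma>1 \<Gamma>2"
      "typing ar \<Gamma>1 (Bang (Const r)) B"
      "typing ar \<Gamma>2 (nest TPair (map (\<lambda>r. Bang (Const r)) (s # rs))) C"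
    by (auto elim: typing_TPairE)
  from \<Gamma>(3) obtain \<Gamma>' where "refines ar \<Gamma>1 \<Gamma>'" "exponential \<Gamma>'" "env \<Gamma>'"
    by (auto elim!: typing_BangE dest: typing_env)
  then have "refines ar \<Gamma>1 {}"
    using refines_exponential refines_trans by (metis env_def)
  moreover have "refines ar \<Gamma>2 {}"
    using 3 \<Gamma>(4) by blast
  ultimately show ?case
    using refines_trans[OF \<Gamma>(1) refines_Un_empty[OF _ _ \<Gamma>(2)]] by blast
qed simp

lemma typing_red_msubst:
  assumes "signature ar den" and "red ar den M N" and "\<And>x. lc 0 (\<theta> x)"
    and "typing ar \<Gamma> (msubst \<theta> M) A"
  shows "typing ar \<Gamma> (msubst \<theta> N) A"
  using assms(2-)
proof (induction arbitrary: \<theta> \<Gamma> A rule: red.induct)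
  case (beta p M V)
  then obtain \<eta> where V: "V = plug \<eta> p"
    using is_value_plug by blast
  have "msubst \<theta> (psubst p V M) =
      msubst (\<lambda>x. if x \<in> set (vars p) then msubst \<theta> (\<eta> x) else \<theta> x) M"
    using psubst_plug[of p \<eta> M] beta.hyps V by (auto simp: msubst_msubst intro: msubst_cong)
  then show ?case
    using typing_beta[OF beta.hyps(1,2) beta.prems(1)] beta.prems(2) V by (simp add: msubst_plug)
next
  case (sym rs f)
  \<comment> \<open>\<open>nest\<close> is unspecified on the empty list, which is excluded because
    arities are at least 1.\<close>
  have "rs \<noteq> []"
    using assms(1) sym.hyps unfolding signature_def by (metis list.size(3) not_one_le_zero)
  have "msubst \<theta> (nest TPair (map (\<lambda>r. Bang (Const r)) rs)) = nest TPair (map (\<lambda>r. Bang (Const r)) rs)"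
    using \<open>rs \<noteq> []\<close> by (induction rs rule: induct_list012) simp_all
  with sym.prems obtain \<Gamma>1 \<Gamma>2 B where \<Gamma>: "refines ar \<Gamma> (\<Gamma>1 \<union> \<Gamma>2)" "joinable \<Gamma>1 \<Gamma>2"
      "typing ar \<Gamma>1 (Sym f) (B \<multimap> A)" "typing ar \<Gamma>2 (nest TPair (map (\<lambda>r. Bang (Const r)) rs)) B"
    by (auto elim: typing_AppE)
  have "A = OfCourse TReal" "refines ar \<Gamma>1 {}"
    using typing_SymE[OF \<Gamma>(3)] by auto
  moreover have "refines ar \<Gamma>2 {}"
    using refines_nest_Bang_Const[OF \<Gamma>(4) \<open>rs \<noteq> []\<close>] .
  ultimately have "refines ar \<Gamma> {}"
    using refines_trans[OF \<Gamma>(1) refines_Un_empty] \<Gamma>(2) by blast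
  moreover have "typing ar {} (Bang (Const (den f rs))) A"
    using typing.prom[OF _ typing.const] \<open>A = OfCourse TReal\<close> by (auto simp: exponential_def)
  ultimately show ?case
    using refines_typing by simp blast
next
  case (plus r s)
  then obtain \<Gamma>1 \<Gamma>2 B where \<Gamma>: "refines ar \<Gamma> (\<Gamma>1 \<union> \<Gamma>2)" "joinable \<Gamma>1 \<Gamma>2"
      "typing ar \<Gamma>1 Plus (B \<multimap> A)" "typing ar \<Gamma>2 (WPair (Const r) (Const s)) B"
    by (auto elim: typing_AppE)
  have "A = TReal" "refines ar \<Gamma>1 {}"
    using typing_PlusE[OF \<Gamma>(3)] by auto
  \<comment> \<open>Both components of an additive pair use all of \<open>\<Gamma>2\<close>, so a
    single nonzero component makes \<open>\<Gamma>2\<close> discardable.\<close>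
  moreover have "r = 0 \<and> s = 0 \<or> refines ar \<Gamma>2 {}"
    using \<Gamma>(4) by (auto elim!: typing_WPairE dest!: typing_ConstE)
  ultimately have "r + s = 0 \<or> refines ar \<Gamma> {}"
    using refines_trans[OF \<Gamma>(1) refines_Un_empty] \<Gamma>(2) by auto
  then show ?case
    using \<open>A = TReal\<close> typing.zero[OF typing_env[OF plus.prems(2)]] typing.const refines_typing
    by (metis msubst.simps(10))
next
  case (times r s)
  then obtain \<Gamma>1 \<Gamma>2 B where \<Gamma>: "refines ar \<Gamma> (\<Gamma>1 \<union> \<Gamma>2)" "joinable \<Gamma>1 \<Gamma>2"
      "typing ar \<Gamma>1 (App Times (Const r)) (B \<multimap> A)" "typing ar \<Gamma>2 (Const s) B"
    by (auto elim: typing_AppE)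
  from \<Gamma>(3) obtain \<Gamma>3 \<Gamma>4 C where \<Gamma>': "refines ar \<Gamma>1 (\<Gamma>3 \<union> \<Gamma>4)" "joinable \<Gamma>3 \<Gamma>4"
      "typing ar \<Gamma>3 Times (C \<multimap> B \<multimap> A)" "typing ar \<Gamma>4 (Const r) C"
    by (auto elim: typing_AppE)
  have "A = TReal" "refines ar \<Gamma>3 {}"
    using typing_TimesE[OF \<Gamma>'(3)] by auto
  \<comment> \<open>A zero factor may hide an environment that cannot be discarded, but then the
    product is zero and \<open>typing.zero\<close> applies.\<close>
  have "r = 0 \<or> refines ar \<Gamma>1 {}"
    using typing_ConstE[OF \<Gamma>'(4)] \<open>refines ar \<Gamma>3 {}\<close> refines_trans[OF \<Gamma>'(1) refines_Un_empty] \<Gamma>'(2)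
    by blast
  then have "r * s = 0 \<or> refines ar \<Gamma> {}"
    using typing_ConstE[OF \<Gamma>(4)] refines_trans[OF \<Gamma>(1) refines_Un_empty] \<Gamma>(2) by auto
  then show ?case
    using \<open>A = TReal\<close> typing.zero[OF typing_env[OF times.prems(2)]] typing.const refines_typing
    by (metis msubst.simps(10))
next
  case (bang M N)
  from bang.prems(2) obtain \<Gamma>' B where \<Gamma>': "A = OfCourse B" "refines ar \<Gamma> \<Gamma>'" "exponential \<Gamma>'"
      "typing ar \<Gamma>' (msubst \<theta> M) B"
    by (auto elim: typing_BangE)
  then show ?case
    using refines_typing[OF \<Gamma>'(2) typing.prom[OF \<Gamma>'(3) bang.IH[of \<theta>, OF bang.prems(1) \<Gamma>'(4)]]] by simp
next
  case (lam p M N)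
  from lam.prems(2) obtain \<Gamma>' q L B where \<Gamma>': "A = pty q \<multimap> B" "refines ar \<Gamma> \<Gamma>'"
      "msubst \<theta> (Lam p M) = Lam q L" "typing ar ({q} \<union> \<Gamma>') L B" "{q} ## \<Gamma>'"
    by (auto simp: Lam_def[of p] elim: typing_AbsE)
  then have shape: "map_pat snd q = map_pat snd p"
    and body: "msubst \<theta> (close (vars p) 0 M) = close (vars q) 0 L"
    by (simp_all add: Lam_def)
  have "lin q"
    using typing_env[OF \<Gamma>'(4)] by (simp add: env_def)
  obtain \<sigma> where \<sigma>: "map \<sigma> (vars p) = vars q"
    using ex_map_distinct same_shape_length[OF shape] lam.hyps(1) by (metis lin_def)
  \<comment> \<open>The instance at which the induction hypothesis is used: it renames
    \<open>p\<close> to the pattern \<open>q\<close> of the derivation, so that \<open>M\<close>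
    becomes \<open>L\<close>.\<close>
  define \<theta>' where "\<theta>' = (\<lambda>x. if x \<in> set (vars p) then FVar (\<sigma> x) else \<theta> x)"
  have "msubst \<theta>' M = bopen (map (\<lambda>x. FVar (\<sigma> x)) (vars p)) 0 (msubst \<theta> (close (vars p) 0 M))"
    unfolding \<theta>'_def using lam.hyps(2) lam.prems(1) by (simp add: bopen_msubst_close is_term_lc)
  also have "map (\<lambda>x. FVar (\<sigma> x)) (vars p) = map FVar (vars q)"
    unfolding \<sigma>[symmetric] by simp
  also have "bopen (map FVar (vars q)) 0 (msubst \<theta> (close (vars p) 0 M)) = L"
    unfolding body using bopen_msubst_close[of FVar 0 L FVar "vars q"] typing_is_term[OF \<Gamma>'(4)]
    by (simp add: msubst_FVar is_term_lc)
  finally have "typing ar ({q} \<union> \<Gamma>') (msubst \<theta>' M) B"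
    using \<Gamma>'(4) by simp
  then have "typing ar ({q} \<union> \<Gamma>') (msubst \<theta>' N) B"
    using lam.prems(1) by (intro lam.IH) (simp add: \<theta>'_def)
  then have "typing ar \<Gamma>' (Lam q (msubst \<theta>' N)) A"
    unfolding \<Gamma>'(1) using \<Gamma>'(5) by (rule typing.lam)
  moreover have "Lam q (msubst \<theta>' N) = msubst \<theta> (Lam p N)"
  proof -
    have "inj_on \<sigma> (set (vars p))"
      using \<open>lin q\<close> unfolding \<sigma>[symmetric] lin_def by (simp add: distinct_map)
    moreover have "fv (\<theta> x) \<inter> \<sigma> ` set (vars p) = {}" if "x \<in> fv N - set (vars p)" for x
    proof -
      \<comment> \<open>By \<open>fv_red\<close>, \<open>x\<close> is already free in
        \<open>Lam p M\<close>, whose instance equals \<open>Lam q L\<close> and hence has no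
        variable of \<open>q\<close> free.\<close>
      have "fv (\<theta> x) \<subseteq> fv (msubst \<theta> (Lam p M))"
        using that fv_red[OF lam.hyps(3)] by (auto simp: fv_msubst fv_Lam)
      moreover have "\<sigma> ` set (vars p) = set (vars q)"
        unfolding \<sigma>[symmetric] by simp
      ultimately show ?thesis
        by (auto simp: \<Gamma>'(3) fv_Lam)
    qed
    ultimately have "close (vars q) 0 (msubst \<theta>' N) = msubst \<theta> (close (vars p) 0 N)"
      unfolding \<sigma>[symmetric] \<theta>'_def by (rule close_msubst)
    then show ?thesis
      by (simp add: Lam_def shape)
  qed
  ultimately show ?case
    using refines_typing[OF \<Gamma>'(2)] by simp
next
  case (appL M N P)
  then obtain \<Gamma>1 \<Gamma>2 B where \<Gamma>: "refines ar \<Gamma> (\<Gamma>1 \<union> \<Gamma>2)" "joinable \<Gamma>1 \<Gamma>2"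
      "typing ar \<Gamma>1 (msubst \<theta> M) (B \<multimap> A)" "typing ar \<Gamma>2 (msubst \<theta> P) B"
    by (auto elim: typing_AppE)
  show ?case
    using refines_typing[OF \<Gamma>(1) typing_App[OF appL.IH[of \<theta>, OF appL.prems(1) \<Gamma>(3)] \<Gamma>(4) \<Gamma>(2)]] by simp
next
  case (appR M N P)
  then obtain \<Gamma>1 \<Gamma>2 B where \<Gamma>: "refines ar \<Gamma> (\<Gamma>1 \<union> \<Gamma>2)" "joinable \<Gamma>1 \<Gamma>2"
      "typing ar \<Gamma>1 (msubst \<theta> P) (B \<multimap> A)" "typing ar \<Gamma>2 (msubst \<theta> M) B"
    by (auto elim: typing_AppE)
  show ?case
    using refines_typing[OF \<Gamma>(1) typing_App[OF \<Gamma>(3) appR.IH[of \<theta>, OF appR.prems(1) \<Gamma>(4)] \<Gamma>(2)]] by simp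
next
  case (tpairL M N P)
  then obtain \<Gamma>1 \<Gamma>2 B C where \<Gamma>: "A = Tensor B C" "refines ar \<Gamma> (\<Gamma>1 \<union> \<Gamma>2)" "joinable \<Gamma>1 \<Gamma>2"
      "typing ar \<Gamma>1 (msubst \<theta> M) B" "typing ar \<Gamma>2 (msubst \<theta> P) C"
    by (auto elim: typing_TPairE)
  show ?case
    using refines_typing[OF \<Gamma>(2) typing_TPair[OF tpairL.IH[of \<theta>, OF tpairL.prems(1) \<Gamma>(4)] \<Gamma>(5) \<Gamma>(3)]] \<Gamma>(1) by simp
next
  case (tpairR M N P)
  then obtain \<Gamma>1 \<Gamma>2 B C where \<Gamma>: "A = Tensor B C" "refines ar \<Gamma> (\<Gamma>1 \<union> \<Gamma>2)" "joinable \<Gamma>1 \<Gamma>2"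
      "typing ar \<Gamma>1 (msubst \<theta> P) B" "typing ar \<Gamma>2 (msubst \<theta> M) C"
    by (auto elim: typing_TPairE)
  show ?case
    using refines_typing[OF \<Gamma>(2) typing_TPair[OF \<Gamma>(4) tpairR.IH[of \<theta>, OF tpairR.prems(1) \<Gamma>(5)] \<Gamma>(3)]] \<Gamma>(1) by simp
next
  case (wpairL M N P)
  from wpairL.prems(2) show ?case
    using wpairL.IH[of \<theta>, OF wpairL.prems(1)] by (auto elim!: typing_WPairE intro: typing.withR)
next
  case (wpairR M N P)
  from wpairR.prems(2) show ?case
    using wpairR.IH[of \<theta>, OF wpairR.prems(1)] by (auto elim!: typing_WPairE intro: typing.withR)
qed

theorem theorem3p1:
  fixes ar :: "'f \<Rightarrow> nat" and den :: "'f \<Rightarrow> real list \<Rightarrow> real"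
    and \<Gamma> :: "var pat set" and M N :: "'f tm" and A :: ty
  assumes "signature ar den"
    and "typing ar \<Gamma> M A"
    and "red ar den M N"
  shows "typing ar \<Gamma> N A"
  using typing_red_msubst[OF assms(1,3), of FVar] assms(2) by (simp add: msubst_FVar)

end
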